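(* Let $E/\mathbb{C}$ be an elliptic curve given by a Weierstrass equation $y^2+a_1xy+a_3y=x^3+a_2x^2+a_4x+a_6$ with $a_1,\dots,a_6\in\mathbb{C}$, with point at infinity $O$ and usual $b$-invariants $b_2,b_4,b_6,b_8$. Let $e_1,e_2,e_3$ be the $x$-coordinates of the three nontrivial $2$-torsion points of $E$ (the three distinct roots of $f(x)=x^3+\frac{b_2}{4}x^2+\frac{b_4}{2}x+\frac{b_6}{4}$), in some fixed order. For $j\in\{1,2,3\}$, with $\{k,l\}=\{1,2,3\}\setminus\{j\}$, put \[ a_{1j}=\frac{2e_ke_l-\frac{b_4}{2}}{2(e_j-e_k)(e_j-e_l)},\qquad a_{2j}=\frac{-1}{2(e_j-e_k)(e_j-e_l)},\qquad b_{j1}=1,\qquad b_{j2}=-e_j. \] Define $\varphi:\mathbb{R}_{\ge 0}^2\to\mathbb{R}_{\ge0}^2$ by \[ \varphi(d_1,d_2)=\left(\sqrt{\sum_{j=1}^3|a_{ij}|\sqrt{|b_{j1}|\,d_1+|b_{j2}|\,d_2}}\right)_{i=1,2}, \] and for $N\ge1$ set $c_N:=\frac{4^N}{4^N-1}\log\big(\|\varphi^{\circ N}(1,1)\|\big)$, where $\|\cdot\|$ is the supremum norm. Then the sequence $(c_N)_{N\ge1}$ is monotonically decreasing, and for every $N\ge 1$, \[ \max_{P\in E(\mathbb{C})}\Psi(P)\le c_N, \] where $\Psi$ is the function defined in the context.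
   Context: Let $\kappa:E\to\mathbb{P}^1$ be the $x$-coordinate map, with $\kappa(O)=(1:0)$. Define $\delta_1(x_1,x_2)=x_1^4-b_4x_1^2x_2^2-2b_6x_1x_2^3-b_8x_2^4$ and $\delta_2(x_1,x_2)=4x_1^3x_2+b_2x_1^2x_2^2+2b_4x_1x_2^3+b_6x_2^4$, so that if $(x_1,x_2)$ represents $\kappa(P)$ then $(\delta_1,\delta_2)(x_1,x_2)$ represents $\kappa(2P)$. For $P\in E(\mathbb{C})$ with $(x_1,x_2)\in\mathbb{C}^2$ representing $\kappa(P)$, let $\Phi(P)=\max\{|\delta_1(x_1,x_2)|,|\delta_2(x_1,x_2)|\}/\max\{|x_1|,|x_2|\}^4$ (usual complex absolute value), and $\Psi(P)=-\sum_{n=0}^\infty 4^{-n-1}\log\Phi(2^nP)$. *)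

theory Defs
  imports "HOL-Analysis.Analysis"
begin

text \<open>
  Weierstrass equations \<open>y\<^sup>2 + a\<^sub>1xy + a\<^sub>3y = x\<^sup>3 + a\<^sub>2x\<^sup>2 + a\<^sub>4x + a\<^sub>6\<close> over the complex numbers.
\<close>

record weierstrass =
  a1 :: complex
  a2 :: complex
  a3 :: complex
  a4 :: complex
  a6 :: complex

definition b2 :: "weierstrass \<Rightarrow> complex" where
  "b2 E = (a1 E)\<^sup>2 + 4 * a2 E"

definition b4 :: "weierstrass \<Rightarrow> complex" where
  "b4 E = 2 * a4 E + a1 E * a3 E"

definition b6 :: "weierstrass \<Rightarrow> complex" where
  "b6 E = (a3 E)\<^sup>2 + 4 * a6 E"

definition b8 :: "weierstrass \<Rightarrow> complex" where
  "b8 E = (a1 E)\<^sup>2 * a6 E + 4 * a2 E * a6 E - a1 E * a3 E * a4 E + a2 E * (a3 E)\<^sup>2 - (a4 E)\<^sup>2"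

definition discriminant :: "weierstrass \<Rightarrow> complex" where
  "discriminant E = - (b2 E)\<^sup>2 * b8 E - 8 * b4 E ^ 3 - 27 * (b6 E)\<^sup>2 + 9 * b2 E * b4 E * b6 E"

definition elliptic_curve :: "weierstrass \<Rightarrow> bool" where
  "elliptic_curve E \<longleftrightarrow> discriminant E \<noteq> 0"

datatype point = Infinity | Affine complex complex

fun on_curve :: "weierstrass \<Rightarrow> point \<Rightarrow> bool" where
  "on_curve E Infinity \<longleftrightarrow> True"
| "on_curve E (Affine x y) \<longleftrightarrow>
     y\<^sup>2 + a1 E * x * y + a3 E * y = x ^ 3 + a2 E * x\<^sup>2 + a4 E * x + a6 E"

definition points :: "weierstrass \<Rightarrow> point set" where
  "points E = {P. on_curve E P}"

text \<open>
  The chord-and-tangent group law: \<open>l\<close> is the slope of the line through the two points (of the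
  tangent line if they coincide), and the third intersection point is reflected by
  \<open>(x, y) \<mapsto> (x, - y - a\<^sub>1x - a\<^sub>3)\<close>.
\<close>

fun add :: "weierstrass \<Rightarrow> point \<Rightarrow> point \<Rightarrow> point" where
  "add E Infinity Q = Q"
| "add E (Affine x1 y1) Infinity = Affine x1 y1"
| "add E (Affine x1 y1) (Affine x2 y2) =
     (if x1 = x2 \<and> y1 + y2 + a1 E * x1 + a3 E = 0 then Infinity
      else
        let l = (if x1 = x2
                 then (3 * x1\<^sup>2 + 2 * a2 E * x1 + a4 E - a1 E * y1) / (2 * y1 + a1 E * x1 + a3 E)
                 else (y2 - y1) / (x2 - x1));
            x = l\<^sup>2 + a1 E * l - a2 E - x1 - x2
        in Affine x (- (y1 + l * (x - x1)) - a1 E * x - a3 E))"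

definition double :: "weierstrass \<Rightarrow> point \<Rightarrow> point" where
  "double E P = add E P P"

definition two_torsion_xs :: "weierstrass \<Rightarrow> complex set" where
  "two_torsion_xs E = {x. \<exists>y. Affine x y \<in> points E \<and> double E (Affine x y) = Infinity}"

lemma two_torsion_xs_eq:
  "two_torsion_xs E = {x. x ^ 3 + b2 E / 4 * x\<^sup>2 + b4 E / 2 * x + b6 E / 4 = 0}"
proof -
  have "x \<in> two_torsion_xs E \<longleftrightarrow> x ^ 3 + b2 E / 4 * x\<^sup>2 + b4 E / 2 * x + b6 E / 4 = 0"
    (is "_ \<longleftrightarrow> ?f = 0") for x
  proof -
    have key: "(2 * y + a1 E * x + a3 E)\<^sup>2 =
        4 * ((y\<^sup>2 + a1 E * x * y + a3 E * y) - (x ^ 3 + a2 E * x\<^sup>2 + a4 E * x + a6 E)) + 4 * ?f" for y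
      by (simp add: b2_def b4_def b6_def field_simps power2_eq_square power3_eq_cube)
    show ?thesis
    proof
      assume "x \<in> two_torsion_xs E"
      then obtain y where c: "on_curve E (Affine x y)" and t: "2 * y + a1 E * x + a3 E = 0"
        by (auto simp: two_torsion_xs_def points_def double_def Let_def split: if_splits)
      from c have "(y\<^sup>2 + a1 E * x * y + a3 E * y) - (x ^ 3 + a2 E * x\<^sup>2 + a4 E * x + a6 E) = 0"
        by simp
      with key[of y] t have "4 * ?f = 0" by (metis add_0 mult_zero_right zero_power2)
      then show "?f = 0" by (metis mult_eq_0_iff zero_neq_numeral)
    next
      assume f: "?f = 0"
      define y where "y = - (a1 E * x + a3 E) / 2"
      have t: "2 * y + a1 E * x + a3 E = 0" by (simp add: y_def field_simps)
      from key[of y] f t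
      have "4 * ((y\<^sup>2 + a1 E * x * y + a3 E * y) - (x ^ 3 + a2 E * x\<^sup>2 + a4 E * x + a6 E)) = 0"
        by (metis add.right_neutral mult_zero_right zero_power2)
      then have "(y\<^sup>2 + a1 E * x * y + a3 E * y) - (x ^ 3 + a2 E * x\<^sup>2 + a4 E * x + a6 E) = 0"
        by (metis mult_eq_0_iff zero_neq_numeral)
      then have "on_curve E (Affine x y)" by simp
      then show "x \<in> two_torsion_xs E"
        using t by (auto simp: two_torsion_xs_def points_def double_def intro!: exI[of _ y])
    qed
  qed
  then show ?thesis by blast
qed

text \<open>
  \<open>represents v P\<close>: the pair \<open>v\<close> consists of homogeneous coordinates of the image of \<open>P\<close> under the
  \<open>x\<close>-coordinate map to the projective line, which sends \<open>Infinity\<close> to \<open>(1 : 0)\<close>.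
\<close>

fun represents :: "complex \<times> complex \<Rightarrow> point \<Rightarrow> bool" where
  "represents (x1, x2) Infinity \<longleftrightarrow> x1 \<noteq> 0 \<and> x2 = 0"
| "represents (x1, x2) (Affine x y) \<longleftrightarrow> x2 \<noteq> 0 \<and> x1 = x * x2"

fun x_rep :: "point \<Rightarrow> complex \<times> complex" where
  "x_rep Infinity = (1, 0)"
| "x_rep (Affine x y) = (x, 1)"

definition \<delta>1 :: "weierstrass \<Rightarrow> complex \<times> complex \<Rightarrow> complex" where
  "\<delta>1 E = (\<lambda>(x1, x2). x1 ^ 4 - b4 E * x1\<^sup>2 * x2\<^sup>2 - 2 * b6 E * x1 * x2 ^ 3 - b8 E * x2 ^ 4)"

definition \<delta>2 :: "weierstrass \<Rightarrow> complex \<times> complex \<Rightarrow> complex" where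
  "\<delta>2 E = (\<lambda>(x1, x2). 4 * x1 ^ 3 * x2 + b2 E * x1\<^sup>2 * x2\<^sup>2 + 2 * b4 E * x1 * x2 ^ 3 + b6 E * x2 ^ 4)"

lemma represents_double:
  assumes E: "elliptic_curve E" and P: "P \<in> points E" and v: "represents v P"
  shows "represents (\<delta>1 E v, \<delta>2 E v) (double E P)"
proof (cases P)
  case Infinity
  with v show ?thesis
    by (cases v) (auto simp: \<delta>1_def \<delta>2_def double_def)
next
  case (Affine x y)
  obtain z where z: "z \<noteq> 0" "v = (z * x, z)"
    using v Affine by (cases v) (auto simp: mult.commute)
  define f where "f = 4 * x ^ 3 + b2 E * x\<^sup>2 + 2 * b4 E * x + b6 E"
  define g where "g = x ^ 4 - b4 E * x\<^sup>2 - 2 * b6 E * x - b8 E"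
  define w where "w = 2 * y + a1 E * x + a3 E"
  have 1: "\<delta>1 E v = z ^ 4 * g"
    unfolding z by (simp add: \<delta>1_def g_def algebra_simps power2_eq_square power3_eq_cube power4_eq_xxxx)
  have 2: "\<delta>2 E v = z ^ 4 * f"
    unfolding z by (simp add: \<delta>2_def f_def algebra_simps power2_eq_square power3_eq_cube power4_eq_xxxx)
  have curve: "y\<^sup>2 + a1 E * x * y + a3 E * y = x ^ 3 + a2 E * x\<^sup>2 + a4 E * x + a6 E"
    using P Affine by (simp add: points_def)
  have wf: "w\<^sup>2 = f"
    using curve unfolding w_def f_def b2_def b4_def b6_def by algebra
  have disc: "discriminant E = (12 * x ^ 3 - b2 E * x\<^sup>2 - 10 * b4 E * x + b2 E * b4 E - 27 * b6 E) * f
      - (48 * x\<^sup>2 + 8 * b2 E * x + 32 * b4 E - (b2 E)\<^sup>2) * g"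
    unfolding discriminant_def f_def g_def b2_def b4_def b6_def b8_def by algebra
  show ?thesis
  proof (cases "w = 0")
    case True
    then have f: "f = 0" using wf by simp
    then have "g \<noteq> 0" using disc E by (auto simp: elliptic_curve_def)
    moreover have "double E P = Infinity"
      using True Affine by (simp add: double_def w_def)
    ultimately show ?thesis unfolding 1 2 using z f by simp
  next
    case False
    define l where "l = (3 * x\<^sup>2 + 2 * a2 E * x + a4 E - a1 E * y) / w"
    have lw: "l * w = 3 * x\<^sup>2 + 2 * a2 E * x + a4 E - a1 E * y" using False by (simp add: l_def)
    obtain y' where d: "double E P = Affine (l\<^sup>2 + a1 E * l - a2 E - x - x) y'"
      using False Affine by (auto simp: double_def w_def l_def Let_def)
    have "(l\<^sup>2 + a1 E * l - a2 E - x - x) * w\<^sup>2 =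
        (l * w)\<^sup>2 + a1 E * (l * w) * w - (a2 E + 2 * x) * w\<^sup>2"
      by (simp add: algebra_simps power2_eq_square)
    also have "\<dots> = g"
      unfolding lw unfolding w_def g_def b4_def b6_def b8_def using curve by algebra
    finally have "g = (l\<^sup>2 + a1 E * l - a2 E - x - x) * f" using wf by simp
    moreover have "f \<noteq> 0" using False wf by auto
    ultimately show ?thesis unfolding 1 2 using z d by simp
  qed
qed

definition \<Phi>_rep :: "weierstrass \<Rightarrow> complex \<times> complex \<Rightarrow> real" where
  "\<Phi>_rep E v = max (cmod (\<delta>1 E v)) (cmod (\<delta>2 E v)) / max (cmod (fst v)) (cmod (snd v)) ^ 4"

text \<open>
  The quotient does not depend on the representative (\<open>\<Phi>_eq\<close> below), so a standard one is used.
\<close>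

definition \<Phi> :: "weierstrass \<Rightarrow> point \<Rightarrow> real" where
  "\<Phi> E P = \<Phi>_rep E (x_rep P)"

lemma represents_iff_scaled_x_rep:
  "represents v P \<longleftrightarrow> (\<exists>c. c \<noteq> 0 \<and> v = (c * fst (x_rep P), c * snd (x_rep P)))"
  by (cases v; cases P) (auto simp: mult.commute)

lemma \<Phi>_rep_scale:
  assumes "c \<noteq> 0"
  shows "\<Phi>_rep E (c * x1, c * x2) = \<Phi>_rep E (x1, x2)"
proof -
  have 1: "\<delta>1 E (c * x1, c * x2) = c ^ 4 * \<delta>1 E (x1, x2)"
    by (simp add: \<delta>1_def algebra_simps power2_eq_square power3_eq_cube power4_eq_xxxx)
  have 2: "\<delta>2 E (c * x1, c * x2) = c ^ 4 * \<delta>2 E (x1, x2)"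
    by (simp add: \<delta>2_def algebra_simps power2_eq_square power3_eq_cube power4_eq_xxxx)
  have m: "max (r * a) (r * b) = r * max a b" if "r \<ge> 0" for r a b :: real
    using that by (simp add: max_mult_distrib_left)
  show ?thesis
    using assms unfolding \<Phi>_rep_def 1 2
    by (simp add: norm_mult norm_power m power_mult_distrib)
qed

lemma \<Phi>_eq:
  assumes "represents v P"
  shows "\<Phi> E P = \<Phi>_rep E v"
  using assms \<Phi>_rep_scale[of _ E "fst (x_rep P)" "snd (x_rep P)"]
  by (auto simp: represents_iff_scaled_x_rep \<Phi>_def)

text \<open>
  \<open>2\<^sup>n P\<close> is the \<open>n\<close>-fold iterated double of \<open>P\<close>.
\<close>

definition \<Psi> :: "weierstrass \<Rightarrow> point \<Rightarrow> real" where
  "\<Psi> E P = - (\<Sum>n. ln (\<Phi> E ((double E ^^ n) P)) / 4 ^ (n + 1))"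

text \<open>
  For \<open>j \<in> {1, 2, 3}\<close>, the set \<open>{1, 2, 3} - {j}\<close> is \<open>{k, l}\<close>.
\<close>

definition coeff_a :: "weierstrass \<Rightarrow> (nat \<Rightarrow> complex) \<Rightarrow> nat \<Rightarrow> nat \<Rightarrow> complex" where
  "coeff_a E e i j =
     (if i = 1 then 2 * (\<Prod>m\<in>{1,2,3} - {j}. e m) - b4 E / 2 else - 1)
       / (2 * (\<Prod>m\<in>{1,2,3} - {j}. e j - e m))"

definition coeff_b :: "(nat \<Rightarrow> complex) \<Rightarrow> nat \<Rightarrow> nat \<Rightarrow> complex" where
  "coeff_b e j i = (if i = 1 then 1 else - e j)"

definition \<phi>_comp :: "weierstrass \<Rightarrow> (nat \<Rightarrow> complex) \<Rightarrow> nat \<Rightarrow> real \<times> real \<Rightarrow> real" where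
  "\<phi>_comp E e i = (\<lambda>(d1, d2).
     sqrt (\<Sum>j\<in>{1,2,3}. cmod (coeff_a E e i j) *
       sqrt (cmod (coeff_b e j 1) * d1 + cmod (coeff_b e j 2) * d2)))"

definition \<phi> :: "weierstrass \<Rightarrow> (nat \<Rightarrow> complex) \<Rightarrow> real \<times> real \<Rightarrow> real \<times> real" where
  "\<phi> E e d = (\<phi>_comp E e 1 d, \<phi>_comp E e 2 d)"

text \<open>
  The library norm on \<^typ>\<open>real \<times> real\<close> is the Euclidean one.
\<close>

definition sup_norm :: "real \<times> real \<Rightarrow> real" where
  "sup_norm d = max \<bar>fst d\<bar> \<bar>snd d\<bar>"

definition c_seq :: "weierstrass \<Rightarrow> (nat \<Rightarrow> complex) \<Rightarrow> nat \<Rightarrow> real" where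
  "c_seq E e N = 4 ^ N / (4 ^ N - 1) * ln (sup_norm ((\<phi> E e ^^ N) (1, 1)))"

end

theory Submission
  imports Defs
begin

text \<open>
  Put \<open>D\<^sub>j = (e\<^sub>j - e\<^sub>k)(e\<^sub>j - e\<^sub>l)\<close> and \<open>z\<^sub>j = (x\<^sub>1 - e\<^sub>j x\<^sub>2)\<^sup>2 - D\<^sub>j x\<^sub>2\<^sup>2\<close>. Then
  \<open>\<delta>\<^sub>1 - e\<^sub>j \<delta>\<^sub>2 = z\<^sub>j\<^sup>2\<close> and \<open>x\<^sub>i\<^sup>2 = \<Sum>\<^sub>j a\<^sub>i\<^sub>j z\<^sub>j\<close>, so that \<open>(\<bar>x\<^sub>1\<bar>, \<bar>x\<^sub>2\<bar>)\<close> is bounded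
  componentwise by \<open>\<phi>(\<bar>\<delta>\<^sub>1\<bar>, \<bar>\<delta>\<^sub>2\<bar>)\<close>. As \<open>\<phi>\<close> is monotone and homogeneous of degree \<open>1/4\<close>, iteration
  gives \<open>\<Psi> P \<le> L\<^sub>N + \<Psi> (2\<^sup>N P) / 4\<^sup>N\<close> with \<open>L\<^sub>N = log \<parallel>\<phi>\<^sup>N(1,1)\<parallel>\<close>. The function \<open>\<Psi>\<close> factors through a
  continuous function on the projective line, so it attains its maximum, and there the inequality
  reads \<open>\<Psi> P \<le> c\<^sub>N\<close>.

  Monotonicity of \<open>c\<^sub>N\<close> fails for general monotone maps homogeneous of degree \<open>1/4\<close>. It holds here
  because \<open>\<phi>\<^sub>1 / \<phi>\<^sub>2\<^bsup>1/4\<^esup>\<close> increases with \<open>d\<^sub>1\<close> and \<open>\<phi>\<^sub>2 / \<phi>\<^sub>1\<^bsup>1/4\<^esup>\<close> increases with \<open>d\<^sub>2\<close>. Both follow from one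
  inequality between sums weighted by \<open>\<bar>a\<^sub>1\<^sub>j\<bar>\<close> and \<open>\<bar>a\<^sub>2\<^sub>j\<bar>\<close>, whose proof orders the \<open>\<bar>e\<^sub>j\<bar>\<close>.
\<close>

section \<open>Averages of iterates in logarithmic coordinates\<close>

text \<open>Up to the factor 4/3, each quotient is the mean of the earlier \<open>V k\<close> with
  weights \<open>1 / 4 ^ k\<close>, so it falls when \<open>V n\<close> is at most that mean. The
  indices \<open>k \<ge> 1\<close> have total weight below 1/3, so an excess of \<open>V n\<close>
  over \<open>V k\<close> of at most \<open>3 * (V 0 - V n)\<close> there is absorbed by index
  0.\<close>

lemma geometric_average_antimono:
  fixes V :: "nat \<Rightarrow> real"
  defines "X \<equiv> \<lambda>n. \<Sum>k<n. V k / 4 ^ k"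
  assumes le: "\<And>k. k \<le> n \<Longrightarrow> V 0 - V k \<le> 4 * (V 0 - V n)" and n: "n \<ge> 1"
  shows "X (Suc n) / (1 - 1 / 4 ^ Suc n) \<le> X n / (1 - 1 / 4 ^ n)"
proof -
  have geo: "(\<Sum>k<n. 1 / 4 ^ k) = 4 / 3 * (1 - 1 / 4 ^ n :: real)" for n
  proof (induction n)
    case (Suc n)
    show ?case unfolding sum.lessThan_Suc Suc.IH by (simp add: field_simps)
  qed simp
  have "(\<Sum>k<n. (V n - V k) / 4 ^ k) = (V n - V 0) + (\<Sum>k\<in>{1..<n}. (V n - V k) / 4 ^ k)"
    using n by (simp add: sum.atLeast_Suc_lessThan lessThan_atLeast0)
  also have "\<dots> \<le> (V n - V 0) + (\<Sum>k\<in>{1..<n}. 3 * (V 0 - V n) / 4 ^ k)"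
    using le by (intro add_left_mono sum_mono divide_right_mono) (force simp: algebra_simps)+
  also have "\<dots> = (V n - V 0) + 3 * (V 0 - V n) * (\<Sum>k\<in>{1..<n}. 1 / 4 ^ k)"
    by (simp add: sum_distrib_left)
  also have "(\<Sum>k\<in>{1..<n}. 1 / 4 ^ k) = (\<Sum>k<n. 1 / 4 ^ k) - (1 :: real)"
    using n by (simp add: sum.atLeast_Suc_lessThan lessThan_atLeast0)
  also have "\<dots> = 1 / 3 - 4 / 3 / 4 ^ n" unfolding geo by (simp add: field_simps)
  also have "(V n - V 0) + 3 * (V 0 - V n) * (1 / 3 - 4 / 3 / 4 ^ n) = - (V 0 - V n) * (4 / 4 ^ n)"
    by (simp add: field_simps)
  also have "\<dots> \<le> 0" using le[of n] by (intro mult_nonpos_nonneg) auto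
  finally have "V n * (\<Sum>k<n. 1 / 4 ^ k) \<le> X n"
    by (simp add: X_def sum_distrib_left sum_subtractf diff_divide_distrib)
  hence "V n * (4 / 3 * (1 - 1 / 4 ^ n)) \<le> X n" unfolding geo .
  from mult_right_mono[OF this, of "3 / 4 / 4 ^ n"]
  have "V n / 4 ^ n * (1 - 1 / 4 ^ n) \<le> X n * (3 / 4 / 4 ^ n)" by (simp add: algebra_simps)
  moreover have "X (Suc n) = X n + V n / 4 ^ n" by (simp add: X_def)
  ultimately have "X (Suc n) * (1 - 1 / 4 ^ n) \<le> X n * (1 - 1 / 4 ^ Suc n)"
    by (simp add: algebra_simps)
  moreover have "1 - 1 / 4 ^ n > (0 :: real)" "1 - 1 / 4 ^ Suc n > (0 :: real)"
    using n one_less_power[of "4 :: real" n] one_less_power[of "4 :: real" "Suc n"] by auto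
  ultimately show ?thesis by (simp add: pos_divide_le_eq pos_le_divide_eq mult.commute)
qed

text \<open>
  The rescaled increments \<open>V, W\<close> of the two coordinates stay between their initial values. When
  \<open>V 0 \<ge> W 0\<close>, the first coordinate is always the larger one, and \<open>g_dep\<close> prevents \<open>V\<close> from returning
  too close to \<open>V 0\<close> after it has dropped.
\<close>

lemma iterate_average_antimono_aux:
  fixes f g :: "real \<Rightarrow> real \<Rightarrow> real" and X Y :: "nat \<Rightarrow> real"
  assumes f_mono: "\<And>x x' y y'. x \<le> x' \<Longrightarrow> y \<le> y' \<Longrightarrow> f x y \<le> f x' y'"
    and g_mono: "\<And>x x' y y'. x \<le> x' \<Longrightarrow> y \<le> y' \<Longrightarrow> g x y \<le> g x' y'"
    and f_hom: "\<And>x y t. f (x + t) (y + t) = f x y + t / 4"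
    and g_hom: "\<And>x y t. g (x + t) (y + t) = g x y + t / 4"
    and g_dep: "\<And>x y y'. y' \<le> y \<Longrightarrow> (f x y - f x y') / 4 \<le> g x y - g x y'"
    and init: "X 0 = 0" "Y 0 = 0"
    and step: "\<And>n. X (Suc n) = f (X n) (Y n)" "\<And>n. Y (Suc n) = g (X n) (Y n)"
    and first: "Y 1 \<le> X 1" and n: "n \<ge> 1"
  shows "max (X (Suc n)) (Y (Suc n)) / (1 - 1 / 4 ^ Suc n) \<le> max (X n) (Y n) / (1 - 1 / 4 ^ n)"
proof -
  define V where "V k = 4 ^ k * (X (Suc k) - X k)" for k
  define W where "W k = 4 ^ k * (Y (Suc k) - Y k)" for k
  have X: "X k = (\<Sum>i<k. V i / 4 ^ i)" and Y: "Y k = (\<Sum>i<k. W i / 4 ^ i)" for k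
    by (simp_all add: V_def W_def sum_lessThan_telescope init)
  have XS: "X (Suc k) = X k + V k / 4 ^ k" and YS: "Y (Suc k) = Y k + W k / 4 ^ k" for k
    by (simp_all add: V_def W_def)
  \<comment> \<open>A common bound on both increments is a common shift by \<open>t / 4 ^ k\<close>;
    monotonicity and homogeneity pass the same bound on to the next pair.\<close>
  have upper: "V (Suc k) \<le> t \<and> W (Suc k) \<le> t" if "V k \<le> t" "W k \<le> t" for k t
  proof -
    have "f (X (Suc k)) (Y (Suc k)) \<le> f (X k + t / 4 ^ k) (Y k + t / 4 ^ k)"
      "g (X (Suc k)) (Y (Suc k)) \<le> g (X k + t / 4 ^ k) (Y k + t / 4 ^ k)"
      unfolding XS YS using that by (auto intro!: f_mono g_mono divide_right_mono)
    thus ?thesis unfolding f_hom g_hom step[symmetric]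
      by (simp add: V_def W_def field_simps)
  qed
  have lower: "t \<le> V (Suc k) \<and> t \<le> W (Suc k)" if "t \<le> V k" "t \<le> W k" for k t
  proof -
    have "f (X k + t / 4 ^ k) (Y k + t / 4 ^ k) \<le> f (X (Suc k)) (Y (Suc k))"
      "g (X k + t / 4 ^ k) (Y k + t / 4 ^ k) \<le> g (X (Suc k)) (Y (Suc k))"
      unfolding XS YS using that by (auto intro!: f_mono g_mono divide_right_mono)
    thus ?thesis unfolding f_hom g_hom step[symmetric]
      by (simp add: V_def W_def field_simps)
  qed
  \<comment> \<open>Shifting by \<open>t\<close> makes the first coordinates agree, so the two
    arguments differ only in the second one and \<open>g_dep\<close> applies.\<close>
  have cross: "W (Suc k) \<le> V k - (V k - V (Suc k)) / 4" if "W k \<le> V k" for k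
  proof -
    define t where "t = V k / 4 ^ k"
    have "Y (Suc k) \<le> Y k + t" using that unfolding YS t_def by (simp add: divide_right_mono)
    from g_dep[OF this, of "X k + t"] have
      "(f (X k) (Y k) + t / 4 - f (X (Suc k)) (Y (Suc k))) / 4
        \<le> g (X k) (Y k) + t / 4 - g (X (Suc k)) (Y (Suc k))"
      unfolding f_hom g_hom by (simp add: XS t_def)
    hence "(t / 4 - V (Suc k) / 4 ^ Suc k) / 4 \<le> t / 4 - W (Suc k) / 4 ^ Suc k"
      unfolding step[symmetric] XS[of "Suc k"] YS[of "Suc k"] by simp
    hence "(V k - V (Suc k)) / 4 / (4 * 4 ^ k) \<le> (V k - W (Suc k)) / (4 * 4 ^ k)"
      by (simp add: t_def diff_divide_distrib)
    thus ?thesis unfolding divide_le_cancel by (simp add: field_simps)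
  qed
  have VW0: "W 0 \<le> V 0" using first by (simp add: V_def W_def init)
  have bounds: "W 0 \<le> V k \<and> W 0 \<le> W k \<and> V k \<le> V 0 \<and> W k \<le> V 0" for k
  proof (induction k)
    case (Suc k)
    thus ?case using upper[of k "V 0"] lower[of "W 0" k] by auto
  qed (use VW0 in auto)
  \<comment> \<open>The bound on \<open>W m\<close> is carried along because \<open>upper\<close>
    propagates only bounds shared by both increments. Solved for \<open>V m\<close> or
    \<open>W m\<close>, each inequality is a bound by \<open>(3 * V 0 + V k) / 4\<close>.\<close>
  have inv: "\<forall>k\<le>m. V 0 - V k \<le> 4 * (V 0 - V m) \<and> V 0 - V k \<le> 4 * (V 0 - W m)" for m
  proof (induction m)
    case (Suc m)
    have old: "V 0 - V k \<le> 4 * (V 0 - V (Suc m)) \<and> V 0 - V k \<le> 4 * (V 0 - W (Suc m))"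
      if "k \<le> m" for k
      using Suc that upper[of m "(3 * V 0 + V k) / 4"] by (auto simp: field_simps)
    have "V 0 - V (Suc m) \<le> 4 * (V 0 - W (Suc m))"
    proof (cases "W m \<le> V m")
      case True
      from cross[OF this] bounds[of m] show ?thesis by (auto simp: field_simps)
    next
      case False
      with lower[of "V m" m] old[of m] show ?thesis by auto
    qed
    with old bounds[of "Suc m"] show ?case by (auto simp: le_Suc_eq)
  qed (use VW0 in auto)
  \<comment> \<open>The later differences \<open>V i - W i\<close> are at least
    \<open>- (V 0 - W 0)\<close> and have total weight below 1/3, so they cannot undo the initial
    lead.\<close>
  have "Y k \<le> X k" for k
  proof (cases k)
    case (Suc j)
    have "X k - Y k = (V 0 - W 0) + (\<Sum>i\<in>{1..j}. (V i - W i) / 4 ^ i)"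
      unfolding X Y Suc by (simp add: sum_subtractf[symmetric] diff_divide_distrib[symmetric]
        sum.atMost_shift lessThan_Suc_atMost sum.atLeast1_atMost_eq)
    moreover have "(\<Sum>i\<in>{1..j}. - (V 0 - W 0) / 4 ^ i) \<le> (\<Sum>i\<in>{1..j}. (V i - W i) / 4 ^ i)"
      using bounds by (intro sum_mono divide_right_mono) (auto, smt (verit) bounds)
    moreover have "(\<Sum>i\<in>{1..j}. - (V 0 - W 0) / 4 ^ i) = - (V 0 - W 0) * ((1 - 1 / 4 ^ j) / 3)"
    proof (induction j)
      case (Suc j)
      have "{1..Suc j} = insert (Suc j) {1..j}" by auto
      hence split: "(\<Sum>i\<in>{1..Suc j}. - (V 0 - W 0) / 4 ^ i) =
          - (V 0 - W 0) / 4 ^ Suc j + (\<Sum>i\<in>{1..j}. - (V 0 - W 0) / 4 ^ i)" by simp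
      show ?case unfolding split Suc.IH by (simp add: field_simps)
    qed simp
    moreover have "(V 0 - W 0) * ((1 - 1 / 4 ^ j) / 3) \<le> (V 0 - W 0) * 1"
    proof (intro mult_left_mono)
      have le: "(1 - q) / 3 \<le> 1" if "q \<ge> 0" for q :: real using that by simp
      show "(1 - 1 / 4 ^ j) / 3 \<le> (1 :: real)" by (rule le) simp
    qed (use VW0 in auto)
    moreover have "c \<ge> 0" if "c = a + s" "t \<le> s" "t = - a * p" "a * p \<le> a * 1" for a c p s t :: real
      using that by simp
    ultimately have "X k - Y k \<ge> 0" by blast
    thus ?thesis by simp
  qed (simp add: init)
  hence "max (X k) (Y k) = X k" for k by (rule max_absorb1)
  moreover have "X (Suc n) / (1 - 1 / 4 ^ Suc n) \<le> X n / (1 - 1 / 4 ^ n)"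
    unfolding X using inv[of n] n by (intro geometric_average_antimono) auto
  ultimately show ?thesis by metis
qed

text \<open>The hypotheses are symmetric under exchange of the coordinates, so whichever leads after
  one step can be taken as the first.\<close>

lemma iterate_average_antimono:
  fixes f g :: "real \<Rightarrow> real \<Rightarrow> real" and X Y :: "nat \<Rightarrow> real"
  assumes f_mono: "\<And>x x' y y'. x \<le> x' \<Longrightarrow> y \<le> y' \<Longrightarrow> f x y \<le> f x' y'"
    and g_mono: "\<And>x x' y y'. x \<le> x' \<Longrightarrow> y \<le> y' \<Longrightarrow> g x y \<le> g x' y'"
    and f_hom: "\<And>x y t. f (x + t) (y + t) = f x y + t / 4"
    and g_hom: "\<And>x y t. g (x + t) (y + t) = g x y + t / 4"
    and f_dep: "\<And>x x' y. x' \<le> x \<Longrightarrow> (g x y - g x' y) / 4 \<le> f x y - f x' y"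
    and g_dep: "\<And>x y y'. y' \<le> y \<Longrightarrow> (f x y - f x y') / 4 \<le> g x y - g x y'"
    and init: "X 0 = 0" "Y 0 = 0"
    and step: "\<And>n. X (Suc n) = f (X n) (Y n)" "\<And>n. Y (Suc n) = g (X n) (Y n)"
    and n: "n \<ge> 1"
  shows "max (X (Suc n)) (Y (Suc n)) / (1 - 1 / 4 ^ Suc n) \<le> max (X n) (Y n) / (1 - 1 / 4 ^ n)"
proof (cases "Y 1 \<le> X 1")
  case True
  with assms show ?thesis by (intro iterate_average_antimono_aux[of f g X Y]) auto
next
  case False
  hence "max (Y (Suc n)) (X (Suc n)) / (1 - 1 / 4 ^ Suc n) \<le> max (Y n) (X n) / (1 - 1 / 4 ^ n)"
    using assms by (intro iterate_average_antimono_aux[of "\<lambda>y x. g x y" "\<lambda>y x. f x y" Y X]) auto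
  thus ?thesis by (simp only: max.commute)
qed

section \<open>The coefficient inequality\<close>

text \<open>
  For suitable \<open>\<kappa>\<close>, the \<open>p\<^sub>j\<close> are the \<open>\<bar>a\<^sub>2\<^sub>j\<bar>\<close>, and \<open>p\<^sub>j r\<^sub>j\<close> are the \<open>\<bar>a\<^sub>1\<^sub>j\<bar>\<close>.
  If \<open>\<bar>v\<bar> \<le> 4 \<bar>u\<bar>\<close>, triangle inequalities coming from \<open>\<Sum>\<^sub>j a\<^sub>1\<^sub>j e\<^sub>j = 0\<close> and \<open>\<Sum>\<^sub>j a\<^sub>2\<^sub>j = 0\<close> keep the largest
  index from dominating; otherwise all \<open>r\<^sub>j\<close> lie within a factor of 3 of each other.
\<close>

lemma weighted_mean_product_le:
  fixes u v w :: complex and \<kappa> y1 y2 y3 :: real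
  defines "p1 \<equiv> \<kappa> * cmod (v - w)" and "p2 \<equiv> \<kappa> * cmod (u - w)" and "p3 \<equiv> \<kappa> * cmod (u - v)"
  defines "r1 \<equiv> cmod (v * w - u * v - u * w)" and "r2 \<equiv> cmod (u * w - v * u - v * w)"
    and "r3 \<equiv> cmod (u * v - w * u - w * v)"
  assumes \<kappa>: "\<kappa> \<ge> 0" and sorted: "cmod u \<le> cmod v" "cmod v \<le> cmod w"
    and y: "0 < y3" "y3 \<le> y2" "y2 \<le> y1"
    and y_sq: "cmod u * y1\<^sup>2 \<le> cmod v * y2\<^sup>2" "cmod v * y2\<^sup>2 \<le> cmod w * y3\<^sup>2"
  shows "(p1 * y1 + p2 * y2 + p3 * y3) *
      (p1 * r1 * cmod u * y1 + p2 * r2 * cmod v * y2 + p3 * r3 * cmod w * y3)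
    \<le> 4 * ((p1 * r1 * y1 + p2 * r2 * y2 + p3 * r3 * y3) *
      (p1 * cmod u * y1 + p2 * cmod v * y2 + p3 * cmod w * y3))"
    (is "?B * ?AE \<le> 4 * (?A * ?BE)")
proof -
  have y_pos: "y1 > 0" "y2 > 0" using y by auto
  have p: "p1 \<ge> 0" "p2 \<ge> 0" "p3 \<ge> 0" using \<kappa> by (auto simp: p1_def p2_def p3_def)
  have r: "r1 \<ge> 0" "r2 \<ge> 0" "r3 \<ge> 0" by (auto simp: r1_def r2_def r3_def)
  define U V W where "U = cmod u" and "V = cmod v" and "W = cmod w"
  have UVW: "0 \<le> U" "U \<le> V" "V \<le> W" using sorted by (auto simp: U_def V_def W_def)
  have nonneg: "?B \<ge> 0" "?AE \<ge> 0" "?A \<ge> 0" "?BE \<ge> 0"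
    using p r y y_pos by auto
  show ?thesis
  proof (cases "V \<le> 4 * U")
    case True
    \<comment> \<open>Three cyclic terms of this shape sum to zero, so the one with the largest
      index is bounded by the other two.\<close>
    have "cmod ((u - v) * (u * v - w * u - w * v) * w) =
        cmod ((v - w) * (v * w - u * v - u * w) * u + (w - u) * (u * w - v * u - v * w) * v)"
      unfolding norm_minus_cancel[symmetric, of "(u - v) * _ * _"]
      by (rule arg_cong[where f = cmod]) algebra
    also have "\<dots> \<le> cmod ((v - w) * (v * w - u * v - u * w) * u) +
        cmod ((w - u) * (u * w - v * u - v * w) * v)"
      by (rule norm_triangle_ineq)
    finally have "\<kappa> * (cmod (u - v) * r3 * W) \<le> \<kappa> * (cmod (v - w) * r1 * U + cmod (u - w) * r2 * V)"
      using \<kappa> by (intro mult_left_mono)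
        (simp_all add: norm_mult r1_def r2_def r3_def U_def V_def W_def norm_minus_commute)
    hence tri: "p3 * r3 * W \<le> p1 * r1 * U + p2 * r2 * V"
      by (simp add: p1_def p2_def p3_def algebra_simps)
    have "?AE \<le> p1 * r1 * U * y1 + p2 * r2 * V * y2 + (p1 * r1 * U + p2 * r2 * V) * y3"
      using mult_right_mono[OF tri, of y3] y by (simp add: U_def V_def W_def)
    also have "\<dots> \<le> p1 * r1 * U * y1 + p2 * r2 * V * y2 + (p1 * r1 * U * y1 + p2 * r2 * V * y2)"
      using y p r UVW unfolding distrib_right
      by (intro add_left_mono add_mono mult_left_mono) auto
    also have "\<dots> = 2 * (U * (p1 * r1 * y1) + V * (p2 * r2 * y2))" by (simp add: algebra_simps)
    also have "\<dots> \<le> 2 * (V * (p1 * r1 * y1) + V * (p2 * r2 * y2) + V * (p3 * r3 * y3))"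
    proof -
      have "U * (p1 * r1 * y1) \<le> V * (p1 * r1 * y1)"
        using UVW p r y_pos by (intro mult_right_mono) auto
      moreover have "0 \<le> V * (p3 * r3 * y3)" using UVW p r y by auto
      ultimately show ?thesis by simp
    qed
    also have "\<dots> = 2 * V * ?A" by (simp add: algebra_simps)
    finally have AE: "?AE \<le> 2 * V * ?A" .

    have "cmod (v - w) \<le> cmod (u - w) + cmod (u - v)"
      using norm_triangle_ineq4[of "u - w" "u - v"] by simp
    from mult_left_mono[OF this \<kappa>] have p_tri: "p1 \<le> p2 + p3"
      by (simp add: p1_def p2_def p3_def algebra_simps)
    have "(V * y2)\<^sup>2 \<le> (W * y3)\<^sup>2"
    proof -
      have "V * (V * y2\<^sup>2) \<le> W * (W * y3\<^sup>2)"
        using UVW y_sq(2) by (rule_tac mult_mono) (auto simp: V_def W_def)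
      thus ?thesis by (simp add: power2_eq_square ac_simps)
    qed
    hence VW: "V * y2 \<le> W * y3" by (rule power2_le_imp_le) (use UVW y in auto)
    \<comment> \<open>If \<open>U = 0\<close> then \<open>V = 0\<close>. Otherwise
      \<open>y_sq\<close> and \<open>V \<le> 4 * U\<close> give \<open>y1 \<le> 2 * y2\<close>,
      hence \<open>V * (y1 - y2) \<le> V * y1 / 2 \<le> 2 * U * y1\<close>.\<close>
    have UV: "V * y1 \<le> 2 * U * y1 + V * y2"
    proof (rule ccontr)
      assume "\<not> ?thesis"
      hence less: "2 * U * y1 < V * (y1 - y2)" by (simp add: algebra_simps)
      have "y2 \<ge> y1 / 2"
      proof -
        have "U * y1\<^sup>2 \<le> (4 * U) * y2\<^sup>2"
          using y_sq(1) True mult_right_mono[OF True, of "y2\<^sup>2"] by (simp add: U_def V_def)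
        moreover have "U > 0"
        proof (rule ccontr)
          assume "\<not> U > 0"
          with UVW True have "U = 0" "V = 0" by auto
          with less show False by simp
        qed
        ultimately have "y1\<^sup>2 \<le> (2 * y2)\<^sup>2" by (simp add: power_mult_distrib)
        hence "y1 \<le> 2 * y2" by (rule power2_le_imp_le) (use y in auto)
        thus ?thesis by simp
      qed
      hence "V * (y1 - y2) \<le> V * (y1 / 2)" using UVW by (intro mult_left_mono) auto
      also have "\<dots> \<le> 4 * U * (y1 / 2)" using True y_pos by (intro mult_right_mono) auto
      finally show False using less by simp
    qed
    have "V * ?B = p1 * (V * y1) + p2 * (V * y2) + p3 * (V * y3)" by (simp add: algebra_simps)
    also have "\<dots> \<le> p1 * (2 * U * y1 + V * y2) + p2 * (V * y2) + p3 * (W * y3)"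
      using p UV UVW y by (intro add_mono mult_left_mono mult_right_mono) auto
    also have "\<dots> \<le> 2 * (p1 * U * y1) + (p2 + p3) * (V * y2) + p2 * (V * y2) + p3 * (W * y3)"
      using mult_right_mono[OF p_tri, of "V * y2"] UVW y by (simp add: algebra_simps)
    also have "\<dots> \<le> 2 * (p1 * U * y1) + 2 * (p2 * V * y2) + 2 * (p3 * W * y3)"
      using mult_left_mono[OF VW, of p3] p by (simp add: algebra_simps)
    also have "\<dots> = 2 * ?BE" by (simp add: U_def V_def W_def)
    finally have B: "V * ?B \<le> 2 * ?BE" .
    \<comment> \<open>The factor \<open>V\<close> moves from the bound on \<open>?AE\<close> to the
      bound on \<open>?B\<close>; the two factors 2 make up the constant 4.\<close>
    have "?B * ?AE \<le> ?B * (2 * V * ?A)" using AE nonneg by (intro mult_left_mono) auto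
    also have "\<dots> = 2 * ?A * (V * ?B)" by (simp add: algebra_simps)
    also have "\<dots> \<le> 2 * ?A * (2 * ?BE)" using B nonneg by (intro mult_left_mono) auto
    finally show ?thesis by (simp add: algebra_simps)
  next
    case False
    \<comment> \<open>Here \<open>4 * U < V\<close>, so \<open>u * v\<close> and
      \<open>u * w\<close> have modulus at most \<open>V * W / 4\<close>, and each \<open>r\<close>
      lies between \<open>m\<close> and \<open>3 * m\<close>.\<close>
    define m where "m = V * W / 2"
    have small: "4 * (U * V) \<le> V * W" "4 * (U * W) \<le> V * W"
    proof -
      have "(4 * U) * V \<le> V * W" using False UVW by (simp add: mult.commute mult_left_mono)
      thus "4 * (U * V) \<le> V * W" by simp
      have "(4 * U) * W \<le> V * W" using False UVW by (intro mult_right_mono) auto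
      thus "4 * (U * W) \<le> V * W" by simp
    qed
    have norms: "cmod (u * v) = U * V" "cmod (u * w) = U * W" "cmod (v * w) = V * W"
      by (simp_all add: U_def V_def W_def norm_mult)
    have range: "m \<le> cmod (v * w + s) \<and> cmod (v * w + s) \<le> 3 * m"
      if "cmod s \<le> U * V + U * W" for s
    proof -
      have "cmod (v * w) - cmod s \<le> cmod (v * w + s)"
        using norm_diff_ineq[of "v * w" s] by simp
      moreover have "cmod (v * w + s) \<le> cmod (v * w) + cmod s" by (rule norm_triangle_ineq)
      ultimately show ?thesis using that small norms by (auto simp: m_def)
    qed
    have "r1 = cmod (v * w + (- (u * v) - u * w))" "r2 = cmod (v * w + (u * v - u * w))"
      "r3 = cmod (v * w + (u * w - u * v))"
      unfolding r1_def r2_def r3_def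
      by (simp add: algebra_simps, (subst norm_minus_cancel[symmetric], simp add: algebra_simps)+)
    moreover have "cmod (- (u * v) - u * w) \<le> U * V + U * W"
      "cmod (u * v - u * w) \<le> U * V + U * W" "cmod (u * w - u * v) \<le> U * V + U * W"
      using norm_triangle_ineq4[of "- (u * v)" "u * w"] norm_triangle_ineq4[of "u * v" "u * w"]
        norm_triangle_ineq4[of "u * w" "u * v"] norms by auto
    ultimately have rm: "m \<le> r1" "m \<le> r2" "m \<le> r3" "r1 \<le> 3 * m" "r2 \<le> 3 * m" "r3 \<le> 3 * m"
      using range by auto
    have m: "m \<ge> 0" using UVW by (auto simp: m_def)
    have "?AE = r1 * (p1 * U * y1) + r2 * (p2 * V * y2) + r3 * (p3 * W * y3)"
      by (simp add: U_def V_def W_def algebra_simps)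
    also have "\<dots> \<le> 3 * m * (p1 * U * y1) + 3 * m * (p2 * V * y2) + 3 * m * (p3 * W * y3)"
      using rm p UVW y y_pos by (intro add_mono mult_right_mono) auto
    also have "\<dots> = 3 * m * ?BE" by (simp add: U_def V_def W_def algebra_simps)
    finally have AE: "?AE \<le> 3 * m * ?BE" .
    have "m * ?B = m * (p1 * y1) + m * (p2 * y2) + m * (p3 * y3)" by (simp add: algebra_simps)
    also have "\<dots> \<le> r1 * (p1 * y1) + r2 * (p2 * y2) + r3 * (p3 * y3)"
      using rm p y y_pos by (intro add_mono mult_right_mono) auto
    also have "\<dots> = ?A" by (simp add: algebra_simps)
    finally have A: "m * ?B \<le> ?A" .
    have "3 * b * a \<le> 4 * (a * b)" if "a \<ge> 0" "b \<ge> 0" for a b :: real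
      using mult_nonneg_nonneg[OF that] by (simp add: mult_ac)
    note three_le_four = this[OF nonneg(3,4)]
    have "?B * ?AE \<le> ?B * (3 * m * ?BE)" using AE nonneg by (intro mult_left_mono) auto
    also have "\<dots> = 3 * ?BE * (m * ?B)" by (simp add: algebra_simps)
    also have "\<dots> \<le> 3 * ?BE * ?A" using A nonneg by (intro mult_left_mono) auto
    also note three_le_four
    finally show ?thesis .
  qed
qed

text \<open>The sums with square roots in the denominator are twice the derivatives of
  \<open>F\<close>, so the last hypothesis says that
  \<open>4 * ln (F \<beta> t) - ln (F \<alpha> t)\<close> has nonnegative derivative.\<close>

lemma ln_sqrt_sum_dependence:
  fixes \<alpha> \<beta> u w :: "'a \<Rightarrow> real" and a b :: real and I :: "'a set"
  defines "F \<equiv> \<lambda>(c :: 'a \<Rightarrow> real) t. \<Sum>j\<in>I. c j * sqrt (u j + w j * t)"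
  assumes ab: "a \<le> b"
    and pos: "\<And>t j. a \<le> t \<Longrightarrow> t \<le> b \<Longrightarrow> j \<in> I \<Longrightarrow> u j + w j * t > 0"
    and F_pos: "\<And>t. a \<le> t \<Longrightarrow> t \<le> b \<Longrightarrow> F \<alpha> t > 0" "\<And>t. a \<le> t \<Longrightarrow> t \<le> b \<Longrightarrow> F \<beta> t > 0"
    and le: "\<And>t. a \<le> t \<Longrightarrow> t \<le> b \<Longrightarrow>
      (\<Sum>j\<in>I. \<alpha> j * w j / sqrt (u j + w j * t)) * F \<beta> t
        \<le> 4 * ((\<Sum>j\<in>I. \<beta> j * w j / sqrt (u j + w j * t)) * F \<alpha> t)"
  shows "ln (F \<alpha> b) - ln (F \<alpha> a) \<le> 4 * (ln (F \<beta> b) - ln (F \<beta> a))"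
proof -
  have "4 * ln (F \<beta> a) - ln (F \<alpha> a) \<le> 4 * ln (F \<beta> b) - ln (F \<alpha> b)"
  proof (rule DERIV_nonneg_imp_nondecreasing[OF ab])
    fix t assume t: "a \<le> t" "t \<le> b"
    define G where "G c = (\<Sum>j\<in>I. c j * w j / sqrt (u j + w j * t))" for c
    have "((\<lambda>t. c j * sqrt (u j + w j * t)) has_real_derivative
        c j * w j / sqrt (u j + w j * t) / 2) (at t)" if "j \<in> I" for c j
      using pos[OF t that] by (auto intro!: derivative_eq_intros simp: field_simps)
    hence deriv: "(F c has_real_derivative G c / 2) (at t)" for c
      unfolding F_def G_def sum_divide_distrib by (intro DERIV_sum) auto
    have "((\<lambda>t. 4 * ln (F \<beta> t) - ln (F \<alpha> t)) has_real_derivative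
        4 * (G \<beta> / 2 / F \<beta> t) - G \<alpha> / 2 / F \<alpha> t) (at t)"
      using F_pos[OF t] by (auto intro!: derivative_eq_intros deriv simp: field_simps)
    moreover have "G \<alpha> * F \<beta> t \<le> 4 * (G \<beta> * F \<alpha> t)" using le[OF t] by (simp add: G_def)
    hence "4 * (G \<beta> / 2 / F \<beta> t) - G \<alpha> / 2 / F \<alpha> t \<ge> 0"
      using F_pos[OF t] by (simp add: field_simps)
    ultimately show "\<exists>y. ((\<lambda>t. 4 * ln (F \<beta> t) - ln (F \<alpha> t)) has_real_derivative y) (at t) \<and> y \<ge> 0"
      by blast
  qed
  thus ?thesis by simp
qed

section \<open>Vieta relations, the quadratic forms \<open>z\<close> and the coefficients\<close>

lemma elementary_symmetric_of_cubic_roots: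
  fixes b c d u v w :: "'a :: field"
  assumes roots: "u ^ 3 + b * u\<^sup>2 + c * u + d = 0" "v ^ 3 + b * v\<^sup>2 + c * v + d = 0"
      "w ^ 3 + b * w\<^sup>2 + c * w + d = 0"
    and distinct: "u \<noteq> v" "u \<noteq> w" "v \<noteq> w"
  shows "b = - (u + v + w)" "c = u * v + u * w + v * w" "d = - (u * v * w)"
proof -
  \<comment> \<open>Subtracting two equations and cancelling the difference of the roots gives
    divided differences; doing so once more isolates \<open>b\<close>.\<close>
  have "(u - v) * (u\<^sup>2 + u * v + v\<^sup>2 + b * (u + v) + c) = 0" using roots by algebra
  hence uv: "u\<^sup>2 + u * v + v\<^sup>2 + b * (u + v) + c = 0" using distinct by simp
  have "(u - w) * (u\<^sup>2 + u * w + w\<^sup>2 + b * (u + w) + c) = 0" using roots by algebra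
  hence uw: "u\<^sup>2 + u * w + w\<^sup>2 + b * (u + w) + c = 0" using distinct by simp
  have "(v - w) * (u + v + w + b) = 0" using uv uw by algebra
  hence "u + v + w + b = 0" using distinct by simp
  thus b: "b = - (u + v + w)" by algebra
  show c: "c = u * v + u * w + v * w" using uv b by algebra
  show "d = - (u * v * w)" using roots(1) unfolding b c by algebra
qed

text \<open>The map \<open>e\<close> fixes the order of the roots; its injectivity keeps the
  denominators of \<open>coeff_a\<close> from vanishing.\<close>

locale two_torsion_numbering =
  fixes E :: weierstrass and e :: "nat \<Rightarrow> complex"
  assumes bij: "bij_betw e {1, 2, 3} (two_torsion_xs E)"
begin

lemma root_distinct: "i \<in> {1,2,3} \<Longrightarrow> j \<in> {1,2,3} \<Longrightarrow> i \<noteq> j \<Longrightarrow> e i \<noteq> e j"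
  using bij by (auto simp: bij_betw_def inj_on_def)

lemma b_invariants:
  "b2 E = - 4 * (e 1 + e 2 + e 3)"
  "b4 E = 2 * (e 1 * e 2 + e 1 * e 3 + e 2 * e 3)"
  "b6 E = - 4 * (e 1 * e 2 * e 3)"
  "b8 E = 4 * (e 1 + e 2 + e 3) * (e 1 * e 2 * e 3) - (e 1 * e 2 + e 1 * e 3 + e 2 * e 3)\<^sup>2"
proof -
  have root: "e j ^ 3 + b2 E / 4 * (e j)\<^sup>2 + b4 E / 2 * e j + b6 E / 4 = 0" if "j \<in> {1,2,3}" for j
    using bij that unfolding two_torsion_xs_eq by (auto simp: bij_betw_def)
  note sym = elementary_symmetric_of_cubic_roots[OF root[of 1] root[of 2] root[of 3]]
  have "e 1 \<noteq> e 2" "e 1 \<noteq> e 3" "e 2 \<noteq> e 3" using root_distinct by auto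
  with sym have b: "b2 E / 4 = - (e 1 + e 2 + e 3)" "b4 E / 2 = e 1 * e 2 + e 1 * e 3 + e 2 * e 3"
      "b6 E / 4 = - (e 1 * e 2 * e 3)" by auto
  show b2: "b2 E = - 4 * (e 1 + e 2 + e 3)"
    and b4: "b4 E = 2 * (e 1 * e 2 + e 1 * e 3 + e 2 * e 3)"
    and b6: "b6 E = - 4 * (e 1 * e 2 * e 3)"
    using b by (simp_all add: field_simps)
  have "4 * b8 E = b2 E * b6 E - (b4 E)\<^sup>2"
    unfolding b2_def b4_def b6_def b8_def by algebra
  also have "\<dots> = 4 * (4 * (e 1 + e 2 + e 3) * (e 1 * e 2 * e 3)
      - (e 1 * e 2 + e 1 * e 3 + e 2 * e 3)\<^sup>2)"
    unfolding b2 b4 b6 by algebra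
  finally show "b8 E = 4 * (e 1 + e 2 + e 3) * (e 1 * e 2 * e 3)
      - (e 1 * e 2 + e 1 * e 3 + e 2 * e 3)\<^sup>2"
    unfolding mult_cancel_left by simp
qed

text \<open>Where \<delta>2 is nonzero, \<open>(z j)\<^sup>2 / \<delta>2\<close> is the x-coordinate
  of the doubled point minus \<open>e j\<close>: the classical fact that this difference is a square
  at doubled points.\<close>

definition z :: "nat \<Rightarrow> complex \<times> complex \<Rightarrow> complex" where
  "z j = (\<lambda>(x1, x2). (x1 - e j * x2)\<^sup>2 - (\<Prod>m\<in>{1,2,3} - {j}. e j - e m) * x2\<^sup>2)"

lemma z_simps:
  "z 1 (x1, x2) = (x1 - e 1 * x2)\<^sup>2 - (e 1 - e 2) * (e 1 - e 3) * x2\<^sup>2"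
  "z 2 (x1, x2) = (x1 - e 2 * x2)\<^sup>2 - (e 2 - e 1) * (e 2 - e 3) * x2\<^sup>2"
  "z 3 (x1, x2) = (x1 - e 3 * x2)\<^sup>2 - (e 3 - e 1) * (e 3 - e 2) * x2\<^sup>2"
  by (simp_all add: z_def insert_Diff_if)

lemma z_square:
  assumes "j \<in> {1,2,3}"
  shows "coeff_b e j 1 * \<delta>1 E x + coeff_b e j 2 * \<delta>2 E x = (z j x)\<^sup>2"
proof (cases x)
  case (Pair x1 x2)
  have "coeff_b e 1 1 * \<delta>1 E x + coeff_b e 1 2 * \<delta>2 E x = (z 1 x)\<^sup>2"
    "coeff_b e 2 1 * \<delta>1 E x + coeff_b e 2 2 * \<delta>2 E x = (z 2 x)\<^sup>2"
    "coeff_b e 3 1 * \<delta>1 E x + coeff_b e 3 2 * \<delta>2 E x = (z 3 x)\<^sup>2"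
    unfolding Pair z_simps coeff_b_def \<delta>1_def \<delta>2_def prod.case b_invariants if_True simp_thms
    by (simp, algebra)+
  thus ?thesis using assms by auto
qed

lemma coeff_a_simps:
  "coeff_a E e 1 1 = (2 * (e 2 * e 3) - b4 E / 2) / (2 * ((e 1 - e 2) * (e 1 - e 3)))"
  "coeff_a E e 1 2 = (2 * (e 1 * e 3) - b4 E / 2) / (2 * ((e 2 - e 1) * (e 2 - e 3)))"
  "coeff_a E e 1 3 = (2 * (e 1 * e 2) - b4 E / 2) / (2 * ((e 3 - e 1) * (e 3 - e 2)))"
  "coeff_a E e 2 1 = - 1 / (2 * ((e 1 - e 2) * (e 1 - e 3)))"
  "coeff_a E e 2 2 = - 1 / (2 * ((e 2 - e 1) * (e 2 - e 3)))"
  "coeff_a E e 2 3 = - 1 / (2 * ((e 3 - e 1) * (e 3 - e 2)))"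
  by (simp_all add: coeff_a_def insert_Diff_if)

text \<open>Each \<open>z j\<close> is a combination of \<open>x1\<^sup>2\<close>,
  \<open>x1 * x2\<close> and \<open>x2\<^sup>2\<close>; the weights \<open>coeff_a\<close> cancel
  the mixed term and the other square.\<close>

lemma sum_coeff_a_z:
  "(\<Sum>j\<in>{1,2,3}. coeff_a E e 1 j * z j (x1, x2)) = x1\<^sup>2"
  "(\<Sum>j\<in>{1,2,3}. coeff_a E e 2 j * z j (x1, x2)) = x2\<^sup>2"
proof -
  define u v w where "u = e 1" and "v = e 2" and "w = e 3"
  have ne: "u - v \<noteq> 0" "u - w \<noteq> 0" "v - w \<noteq> 0"
    using root_distinct[of 1 2] root_distinct[of 1 3] root_distinct[of 2 3]
    by (auto simp: u_def v_def w_def)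
  \<comment> \<open>A common denominator reduces both claims to polynomial identities.\<close>
  define D where "D = 2 * ((u - v) * (u - w) * (v - w))"
  have D: "D \<noteq> 0" using ne by (simp add: D_def)
  have split: "p / (2 * ((u - v) * (u - w))) = p * (v - w) / D"
    "p / (2 * ((v - u) * (v - w))) = - p * (u - w) / D"
    "p / (2 * ((w - u) * (w - v))) = p * (u - v) / D" for p
  proof -
    have neg: "(v - u) * (v - w) = - ((u - v) * (v - w))" "(w - u) * (w - v) = (u - w) * (v - w)"
      by algebra+
    show "p / (2 * ((u - v) * (u - w))) = p * (v - w) / D"
      "p / (2 * ((v - u) * (v - w))) = - p * (u - w) / D"
      "p / (2 * ((w - u) * (w - v))) = p * (u - v) / D"
      using ne unfolding D_def neg by simp_all
  qed
  have combine: "a / D * x + (b / D * y + c / D * t) = s"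
    if "a * x + b * y + c * t = s * D" for a b c x y t s
  proof -
    have "a / D * x + (b / D * y + c / D * t) = (a * x + b * y + c * t) / D"
      by (simp add: add_divide_distrib)
    thus ?thesis using that D by simp
  qed
  have sum3: "(\<Sum>j\<in>{1,2,3}. f j) = f 1 + (f 2 + f 3)" for f :: "nat \<Rightarrow> complex" by simp
  have b4: "b4 E / 2 = e 1 * e 2 + e 1 * e 3 + e 2 * e 3" by (simp add: b_invariants)
  show "(\<Sum>j\<in>{1,2,3}. coeff_a E e 1 j * z j (x1, x2)) = x1\<^sup>2"
    "(\<Sum>j\<in>{1,2,3}. coeff_a E e 2 j * z j (x1, x2)) = x2\<^sup>2"
    unfolding sum3 coeff_a_simps z_simps b4 unfolding u_def[symmetric] v_def[symmetric]
      w_def[symmetric] split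
    by (rule combine, simp add: D_def algebra_simps power2_eq_square)+
qed

lemma sorted_roots:
  obtains i j k where "{1, 2, 3} = {i, j, k}" "i \<noteq> j" "i \<noteq> k" "j \<noteq> k"
    "cmod (e i) \<le> cmod (e j)" "cmod (e j) \<le> cmod (e k)"
proof -
  have perms: "{1, 2, 3 :: nat} = {1, 3, 2}" "{1, 2, 3 :: nat} = {2, 1, 3}" "{1, 2, 3 :: nat} = {2, 3, 1}"
    "{1, 2, 3 :: nat} = {3, 1, 2}" "{1, 2, 3 :: nat} = {3, 2, 1}" by auto
  consider "cmod (e 1) \<le> cmod (e 2)" "cmod (e 2) \<le> cmod (e 3)"
    | "cmod (e 1) \<le> cmod (e 3)" "cmod (e 3) \<le> cmod (e 2)"
    | "cmod (e 2) \<le> cmod (e 1)" "cmod (e 1) \<le> cmod (e 3)"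
    | "cmod (e 2) \<le> cmod (e 3)" "cmod (e 3) \<le> cmod (e 1)"
    | "cmod (e 3) \<le> cmod (e 1)" "cmod (e 1) \<le> cmod (e 2)"
    | "cmod (e 3) \<le> cmod (e 2)" "cmod (e 2) \<le> cmod (e 1)"
    by linarith
  thus ?thesis
  proof cases
    case 1 thus ?thesis by (intro that[of 1 2 3]) auto
  next
    case 2 thus ?thesis by (intro that[OF perms(1)]) auto
  next
    case 3 thus ?thesis by (intro that[OF perms(2)]) auto
  next
    case 4 thus ?thesis by (intro that[OF perms(3)]) auto
  next
    case 5 thus ?thesis by (intro that[OF perms(4)]) auto
  next
    case 6 thus ?thesis by (intro that[OF perms(5)]) auto
  qed
qed

lemma coeff_a_norm:
  assumes I: "{1, 2, 3} = {i, j, k}" and ne: "i \<noteq> j" "i \<noteq> k" "j \<noteq> k"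
  defines "\<kappa> \<equiv> 1 / (2 * (cmod (e i - e j) * cmod (e i - e k) * cmod (e j - e k)))"
  shows "cmod (coeff_a E e 2 i) = \<kappa> * cmod (e j - e k)"
    "cmod (coeff_a E e 1 i) = \<kappa> * cmod (e j - e k) * cmod (e j * e k - e i * e j - e i * e k)"
proof -
  have diff: "{1, 2, 3} - {i} = {j, k}" unfolding I using ne by auto
  have e: "e j - e k \<noteq> 0"
    using root_distinct[of j k] I ne by (metis eq_iff_diff_eq_0 insertCI)
  have \<kappa>: "\<kappa> * cmod (e j - e k) = 1 / (2 * (cmod (e i - e j) * cmod (e i - e k)))"
    using e by (simp add: \<kappa>_def)
  have "b4 E / 2 = e 1 * e 2 + e 1 * e 3 + e 2 * e 3" by (simp add: b_invariants)
  \<comment> \<open>Power sums depend only on the index set, which can then be rewritten as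
    \<open>{i, j, k}\<close>.\<close>
  also have "\<dots> = ((\<Sum>m\<in>{1,2,3}. e m)\<^sup>2 - (\<Sum>m\<in>{1,2,3}. (e m)\<^sup>2)) / 2"
    by (simp add: power2_eq_square algebra_simps)
  also have "\<dots> = e i * e j + e i * e k + e j * e k"
    unfolding I using ne by (simp add: power2_eq_square algebra_simps)
  finally have b4: "b4 E / 2 = e i * e j + e i * e k + e j * e k" .
  show "cmod (coeff_a E e 2 i) = \<kappa> * cmod (e j - e k)"
    unfolding coeff_a_def diff \<kappa> using ne by (simp add: norm_divide norm_mult)
  show "cmod (coeff_a E e 1 i) = \<kappa> * cmod (e j - e k) * cmod (e j * e k - e i * e j - e i * e k)"
    unfolding coeff_a_def diff \<kappa> b4 using ne
    by (simp add: norm_divide norm_mult) (simp add: algebra_simps)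
qed

text \<open>This is \<open>weighted_mean_product_le\<close> with the values \<open>1 / s j\<close>
  as the \<open>y\<close>, and the common source of both halves of
  \<open>\<phi>_comp_dependence\<close>.\<close>

lemma coeff_a_weighted_le:
  fixes d1 d2 :: real
  assumes d: "d1 > 0" "d2 > 0"
  defines "s \<equiv> \<lambda>j. sqrt (d1 + cmod (e j) * d2)"
  shows "(\<Sum>j\<in>{1,2,3}. cmod (coeff_a E e 2 j) / s j) *
      (\<Sum>j\<in>{1,2,3}. cmod (coeff_a E e 1 j) * cmod (e j) / s j)
    \<le> 4 * ((\<Sum>j\<in>{1,2,3}. cmod (coeff_a E e 1 j) / s j) *
      (\<Sum>j\<in>{1,2,3}. cmod (coeff_a E e 2 j) * cmod (e j) / s j))"
proof -
  obtain i j k where I: "{1, 2, 3} = {i, j, k}" and ne: "i \<noteq> j" "i \<noteq> k" "j \<noteq> k"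
    and sorted: "cmod (e i) \<le> cmod (e j)" "cmod (e j) \<le> cmod (e k)" by (rule sorted_roots)
  have arg_pos: "d1 + cmod (e m) * d2 > 0" for m using d by (simp add: add_pos_nonneg)
  have s_pos: "s m > 0" for m using arg_pos by (simp add: s_def)
  have s_sq: "(1 / s m)\<^sup>2 = 1 / (d1 + cmod (e m) * d2)" for m
    using arg_pos[of m] by (simp add: s_def power_divide)
  have s_mono: "1 / s n \<le> 1 / s m" if "cmod (e m) \<le> cmod (e n)" for m n
  proof -
    have "s m \<le> s n" using that d by (simp add: s_def mult_right_mono)
    thus ?thesis using s_pos by (intro frac_le) auto
  qed
  \<comment> \<open>The function \<open>x / (d1 + x * d2)\<close> increases for
    \<open>x \<ge> 0\<close>.\<close>
  have s_sq_mono: "cmod (e m) * (1 / s m)\<^sup>2 \<le> cmod (e n) * (1 / s n)\<^sup>2"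
    if "cmod (e m) \<le> cmod (e n)" for m n
    unfolding s_sq using that d arg_pos[of m] arg_pos[of n]
    by (simp add: field_simps)
  have I': "{1, 2, 3} = {j, i, k}" "{1, 2, 3} = {k, i, j}" using I by auto
  define \<kappa> where "\<kappa> = 1 / (2 * (cmod (e i - e j) * cmod (e i - e k) * cmod (e j - e k)))"
  have coeff:
    "cmod (coeff_a E e 2 i) = \<kappa> * cmod (e j - e k)"
    "cmod (coeff_a E e 2 j) = \<kappa> * cmod (e i - e k)"
    "cmod (coeff_a E e 2 k) = \<kappa> * cmod (e i - e j)"
    "cmod (coeff_a E e 1 i) = \<kappa> * cmod (e j - e k) * cmod (e j * e k - e i * e j - e i * e k)"
    "cmod (coeff_a E e 1 j) = \<kappa> * cmod (e i - e k) * cmod (e i * e k - e j * e i - e j * e k)"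
    "cmod (coeff_a E e 1 k) = \<kappa> * cmod (e i - e j) * cmod (e i * e j - e k * e i - e k * e j)"
    using coeff_a_norm[OF I ne] coeff_a_norm[OF I'(1)] coeff_a_norm[OF I'(2)] ne
    by (simp_all add: \<kappa>_def norm_minus_commute mult_ac)
  have "\<kappa> \<ge> 0" by (simp add: \<kappa>_def)
  from weighted_mean_product_le[OF this sorted, of "1 / s k" "1 / s j" "1 / s i"]
  show ?thesis unfolding I using ne s_pos[of k] s_mono s_sq_mono sorted by (simp add: coeff add.assoc del: One_nat_def)
qed

end

section \<open>Monotonicity of the bounds\<close>

context two_torsion_numbering
begin

lemma \<phi>_comp_eq:
  "\<phi>_comp E e i (d1, d2) =
    sqrt (\<Sum>j\<in>{1,2,3}. cmod (coeff_a E e i j) * sqrt (d1 + cmod (e j) * d2))"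
  by (simp add: \<phi>_comp_def coeff_b_def)

lemma \<phi>_comp_mono:
  assumes "d1 \<le> d1'" "d2 \<le> d2'"
  shows "\<phi>_comp E e i (d1, d2) \<le> \<phi>_comp E e i (d1', d2')"
  unfolding \<phi>_comp_eq using assms
  by (intro real_sqrt_le_mono sum_mono mult_left_mono add_mono) auto

text \<open>Two nested square roots give degree 1/4; scaling by \<open>t ^ 4\<close> keeps the
  exponents integral.\<close>

lemma \<phi>_comp_scale:
  assumes "t \<ge> 0"
  shows "\<phi>_comp E e i (t ^ 4 * d1, t ^ 4 * d2) = t * \<phi>_comp E e i (d1, d2)"
proof -
  have root: "sqrt (t ^ 4 * d1 + c * (t ^ 4 * d2)) = t\<^sup>2 * sqrt (d1 + c * d2)" for c
  proof -
    have "t ^ 4 * d1 + c * (t ^ 4 * d2) = (t\<^sup>2)\<^sup>2 * (d1 + c * d2)" by (simp add: algebra_simps)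
    thus ?thesis by (simp only: real_sqrt_mult real_sqrt_abs abs_power2)
  qed
  have "\<phi>_comp E e i (t ^ 4 * d1, t ^ 4 * d2) =
      sqrt (t\<^sup>2 * (\<Sum>j\<in>{1,2,3}. cmod (coeff_a E e i j) * sqrt (d1 + cmod (e j) * d2)))"
    unfolding \<phi>_comp_eq sum_distrib_left root by (simp only: mult.left_commute)
  thus ?thesis using assms by (simp add: real_sqrt_mult \<phi>_comp_eq)
qed

lemma norm_z_le:
  assumes "j \<in> {1,2,3}"
  shows "cmod (z j x) \<le> sqrt (cmod (\<delta>1 E x) + cmod (e j) * cmod (\<delta>2 E x))"
proof (rule real_le_rsqrt)
  have "(cmod (z j x))\<^sup>2 = cmod (\<delta>1 E x + - e j * \<delta>2 E x)"
    using z_square[OF assms, of x] by (simp add: coeff_b_def norm_power[symmetric])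
  also have "\<dots> \<le> cmod (\<delta>1 E x) + cmod (e j) * cmod (\<delta>2 E x)"
    by (rule order_trans[OF norm_triangle_ineq]) (simp add: norm_mult)
  finally show "(cmod (z j x))\<^sup>2 \<le> cmod (\<delta>1 E x) + cmod (e j) * cmod (\<delta>2 E x)" .
qed

lemma norm_le_\<phi>_comp:
  "cmod (fst x) \<le> \<phi>_comp E e 1 (cmod (\<delta>1 E x), cmod (\<delta>2 E x))"
  "cmod (snd x) \<le> \<phi>_comp E e 2 (cmod (\<delta>1 E x), cmod (\<delta>2 E x))"
proof -
  have "cmod y \<le> \<phi>_comp E e i (cmod (\<delta>1 E x), cmod (\<delta>2 E x))"
    if y: "(\<Sum>j\<in>{1,2,3}. coeff_a E e i j * z j x) = y\<^sup>2" for i y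
  proof -
    have "(cmod y)\<^sup>2 = cmod (\<Sum>j\<in>{1,2,3}. coeff_a E e i j * z j x)"
      unfolding y by (simp add: norm_power)
    also have "\<dots> \<le> (\<Sum>j\<in>{1,2,3}. cmod (coeff_a E e i j) * cmod (z j x))"
      by (rule order_trans[OF norm_sum]) (simp add: norm_mult)
    also have "\<dots> \<le> (\<Sum>j\<in>{1,2,3}. cmod (coeff_a E e i j) *
        sqrt (cmod (\<delta>1 E x) + cmod (e j) * cmod (\<delta>2 E x)))"
      by (intro sum_mono mult_left_mono norm_z_le) auto
    finally show ?thesis unfolding \<phi>_comp_eq by (intro real_le_rsqrt)
  qed
  from this[of 1 "fst x"] this[of 2 "snd x"]
  show "cmod (fst x) \<le> \<phi>_comp E e 1 (cmod (\<delta>1 E x), cmod (\<delta>2 E x))"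
    "cmod (snd x) \<le> \<phi>_comp E e 2 (cmod (\<delta>1 E x), cmod (\<delta>2 E x))"
    using sum_coeff_a_z[of "fst x" "snd x"] by (auto simp del: One_nat_def)
qed

text \<open>Were the value zero, all coefficients in row \<open>i\<close> would vanish and
  \<open>norm_le_\<phi>_comp\<close> at \<open>(1, 1)\<close> would give
  \<open>1 \<le> 0\<close>.\<close>

lemma \<phi>_comp_pos:
  assumes i: "i \<in> {1, 2}" and d: "d1 > 0" "d2 > 0"
  shows "\<phi>_comp E e i (d1, d2) > 0"
proof (rule ccontr)
  assume "\<not> ?thesis"
  moreover have arg: "d1 + cmod (e j) * d2 > 0" for j using d by (simp add: add_pos_nonneg)
  have nonneg: "cmod (coeff_a E e i j) * sqrt (d1 + cmod (e j) * d2) \<ge> 0" for j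
    using arg[of j] by simp
  ultimately have "(\<Sum>j\<in>{1,2,3}. cmod (coeff_a E e i j) * sqrt (d1 + cmod (e j) * d2)) \<le> 0"
    unfolding \<phi>_comp_eq by (simp del: sum.insert)
  hence "(\<Sum>j\<in>{1,2,3}. cmod (coeff_a E e i j) * sqrt (d1 + cmod (e j) * d2)) = 0"
    using nonneg by (intro antisym sum_nonneg) auto
  hence "\<forall>j\<in>{1,2,3}. cmod (coeff_a E e i j) * sqrt (d1 + cmod (e j) * d2) = 0"
    using nonneg by (subst (asm) sum_nonneg_eq_0_iff) auto
  hence "coeff_a E e i j = 0" if "j \<in> {1,2,3}" for j using that arg[of j] by force
  hence "\<phi>_comp E e i d = 0" for d by (cases d) (simp add: \<phi>_comp_eq)
  thus False using norm_le_\<phi>_comp[of "(1, 1)"] i by auto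
qed

text \<open>Up to the factor 2, \<open>S0\<close> and \<open>S1\<close> are the partial derivatives
  of \<open>F\<close>, and Euler's relation expands \<open>F\<close> in them. In both derivative
  inequalities the diagonal products occur with factor 1 on the left and 4 on the right, and what
  remains is a multiple of \<open>key\<close>.\<close>

lemma \<phi>_comp_dependence:
  fixes d1 d2 :: real
  assumes d: "d1 > 0" "d2 > 0"
  shows "d1 \<le> d1' \<Longrightarrow> ln (\<phi>_comp E e 2 (d1', d2)) - ln (\<phi>_comp E e 2 (d1, d2))
      \<le> 4 * (ln (\<phi>_comp E e 1 (d1', d2)) - ln (\<phi>_comp E e 1 (d1, d2)))"
    and "d2 \<le> d2' \<Longrightarrow> ln (\<phi>_comp E e 1 (d1, d2')) - ln (\<phi>_comp E e 1 (d1, d2))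
      \<le> 4 * (ln (\<phi>_comp E e 2 (d1, d2')) - ln (\<phi>_comp E e 2 (d1, d2)))"
proof -
  define A where "A i j = cmod (coeff_a E e i j)" for i j
  define s where "s t1 t2 j = sqrt (t1 + cmod (e j) * t2)" for t1 t2 j
  define S0 where "S0 i t1 t2 = (\<Sum>j\<in>{1,2,3}. A i j / s t1 t2 j)" for i t1 t2
  define S1 where "S1 i t1 t2 = (\<Sum>j\<in>{1,2,3}. A i j * cmod (e j) / s t1 t2 j)" for i t1 t2
  define F where "F i t1 t2 = (\<Sum>j\<in>{1,2,3}. A i j * s t1 t2 j)" for i t1 t2
  have arg: "t1 + cmod (e j) * t2 > 0" if "t1 > 0" "t2 > 0" for j t1 t2
    using that by (simp add: add_pos_nonneg)
  have s_pos: "s t1 t2 j > 0" if "t1 > 0" "t2 > 0" for j t1 t2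
    unfolding s_def using arg[OF that] by simp
  have S_nonneg: "S0 i t1 t2 \<ge> 0" "S1 i t1 t2 \<ge> 0" if "t1 > 0" "t2 > 0" for i t1 t2
    unfolding S0_def S1_def using s_pos[OF that]
    by (auto intro!: sum_nonneg divide_nonneg_pos simp: A_def simp del: sum.insert)
  have F: "F i t1 t2 = t1 * S0 i t1 t2 + t2 * S1 i t1 t2" if "t1 > 0" "t2 > 0" for i t1 t2
  proof -
    have "A i j * s t1 t2 j = t1 * (A i j / s t1 t2 j) + t2 * (A i j * cmod (e j) / s t1 t2 j)" for j
    proof -
      have "s t1 t2 j * s t1 t2 j = t1 + cmod (e j) * t2"
        unfolding s_def using arg[OF that, of j] by simp
      hence "A i j * (s t1 t2 j * s t1 t2 j) = t1 * A i j + t2 * (A i j * cmod (e j))"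
        by (simp add: algebra_simps)
      thus ?thesis using s_pos[OF that, of j] by (simp add: field_simps)
    qed
    thus ?thesis unfolding F_def S0_def S1_def sum_distrib_left sum.distrib[symmetric] by simp
  qed
  have key: "S0 2 t1 t2 * S1 1 t1 t2 \<le> 4 * (S0 1 t1 t2 * S1 2 t1 t2)" if "t1 > 0" "t2 > 0" for t1 t2
    unfolding S0_def S1_def A_def s_def by (rule coeff_a_weighted_le[OF that])
  have \<phi>_F: "\<phi>_comp E e i (t1, t2) = sqrt (F i t1 t2)" for i t1 t2
    unfolding \<phi>_comp_eq F_def A_def s_def ..
  have F_pos: "F i t1 t2 > 0" if "i \<in> {1, 2}" "t1 > 0" "t2 > 0" for i t1 t2
    using \<phi>_comp_pos[OF that] unfolding \<phi>_F by simp
  have ln_\<phi>: "ln (\<phi>_comp E e i (t1, t2)) = ln (F i t1 t2) / 2" if "i \<in> {1, 2}" "t1 > 0" "t2 > 0" for i t1 t2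
    unfolding \<phi>_F using F_pos[OF that] by (simp add: ln_sqrt)
  show "ln (\<phi>_comp E e 2 (d1', d2)) - ln (\<phi>_comp E e 2 (d1, d2))
      \<le> 4 * (ln (\<phi>_comp E e 1 (d1', d2)) - ln (\<phi>_comp E e 1 (d1, d2)))" if "d1 \<le> d1'"
  proof -
    have s: "sqrt (cmod (e j) * d2 + 1 * t) = s t d2 j" for j t by (simp add: s_def add.commute)
    have "S0 2 t d2 * F 1 t d2 \<le> 4 * (S0 1 t d2 * F 2 t d2)" if "d1 \<le> t" for t
    proof -
      have t: "t > 0" using that d by simp
      have "0 \<le> t * (S0 1 t d2 * S0 2 t d2)" using S_nonneg[OF t d(2)] t by simp
      moreover have "d2 * (S0 2 t d2 * S1 1 t d2) \<le> d2 * (4 * (S0 1 t d2 * S1 2 t d2))"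
        using key[OF t d(2)] d by (intro mult_left_mono) auto
      ultimately show ?thesis unfolding F[OF t d(2)] by (simp add: algebra_simps)
    qed
    hence "ln (F 2 d1' d2) - ln (F 2 d1 d2) \<le> 4 * (ln (F 1 d1' d2) - ln (F 1 d1 d2))"
      using ln_sqrt_sum_dependence[of d1 d1' "{1,2,3}" "\<lambda>j. cmod (e j) * d2" "\<lambda>_. 1" "A 2" "A 1"]
        that d F_pos arg
      unfolding s F_def[symmetric] mult_1_right S0_def[symmetric]
      by (auto simp: add.commute simp del: sum.insert One_nat_def)
    thus ?thesis using that d by (simp add: ln_\<phi>)
  qed
  show "ln (\<phi>_comp E e 1 (d1, d2')) - ln (\<phi>_comp E e 1 (d1, d2))
      \<le> 4 * (ln (\<phi>_comp E e 2 (d1, d2')) - ln (\<phi>_comp E e 2 (d1, d2)))" if "d2 \<le> d2'"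
  proof -
    have "S1 1 d1 t * F 2 d1 t \<le> 4 * (S1 2 d1 t * F 1 d1 t)" if "d2 \<le> t" for t
    proof -
      have t: "t > 0" using that d by simp
      have "0 \<le> t * (S1 1 d1 t * S1 2 d1 t)" using S_nonneg[OF d(1) t] t by simp
      moreover have "d1 * (S0 2 d1 t * S1 1 d1 t) \<le> d1 * (4 * (S0 1 d1 t * S1 2 d1 t))"
        using key[OF d(1) t] d by (intro mult_left_mono) auto
      ultimately show ?thesis unfolding F[OF d(1) t] by (simp add: algebra_simps)
    qed
    hence "ln (F 1 d1 d2') - ln (F 1 d1 d2) \<le> 4 * (ln (F 2 d1 d2') - ln (F 2 d1 d2))"
      using ln_sqrt_sum_dependence[of d2 d2' "{1,2,3}" "\<lambda>_. d1" "\<lambda>j. cmod (e j)" "A 1" "A 2"]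
        that d F_pos arg
      unfolding s_def[symmetric] F_def[symmetric] S1_def[symmetric]
      by (auto simp del: sum.insert One_nat_def)
    thus ?thesis using that d by (simp add: ln_\<phi>)
  qed
qed

lemma \<phi>_iterate_pos: "fst ((\<phi> E e ^^ n) (1, 1)) > 0" "snd ((\<phi> E e ^^ n) (1, 1)) > 0"
proof (induction n)
  case (Suc n)
  obtain p q where pq: "(\<phi> E e ^^ n) (1, 1) = (p, q)" by fastforce
  hence "p > 0" "q > 0" using Suc by simp_all
  thus "fst ((\<phi> E e ^^ Suc n) (1, 1)) > 0" "snd ((\<phi> E e ^^ Suc n) (1, 1)) > 0"
    using pq \<phi>_comp_pos[of 1 p q] \<phi>_comp_pos[of 2 p q] by (simp_all add: \<phi>_def)
qed auto

text \<open>This is the quotient form of \<open>iterate_average_antimono\<close>. At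
  \<open>n = 0\<close> both sides are 0 because division by zero gives 0.\<close>

lemma c_seq_eq:
  "c_seq E e n = max (ln (fst ((\<phi> E e ^^ n) (1, 1)))) (ln (snd ((\<phi> E e ^^ n) (1, 1)))) / (1 - 1 / 4 ^ n)"
proof -
  have "ln (max x y) = max (ln x) (ln y)" if "x > 0" "y > 0" for x y :: real
    using that by (auto simp: max_def)
  moreover have "4 ^ n / (4 ^ n - 1) * x = x / (1 - 1 / 4 ^ n)" for x :: real
  proof -
    have "1 - 1 / 4 ^ n = (4 ^ n - 1) / (4 ^ n :: real)" by (simp add: diff_divide_distrib)
    thus ?thesis by simp
  qed
  ultimately show ?thesis
    using \<phi>_iterate_pos[of n] by (simp add: c_seq_def sup_norm_def)
qed

lemma c_seq_antimono: "antimono_on {1..} (c_seq E e)"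
proof -
  have c_step: "c_seq E e (Suc n) \<le> c_seq E e n" if "n \<ge> 1" for n
  proof -
    \<comment> \<open>In logarithmic coordinates, degree 1/4 turns into
      \<open>f (x + t) (y + t) = f x y + t / 4\<close>.\<close>
    define f where "f i x y = ln (\<phi>_comp E e i (exp x, exp y))" for i x y
    have pos: "\<phi>_comp E e i (exp x, exp y) > 0" if "i \<in> {1, 2}" for i x y
      using \<phi>_comp_pos[OF that] by simp
    have mono: "f i x y \<le> f i x' y'" if "i \<in> {1, 2}" "x \<le> x'" "y \<le> y'" for i x y x' y'
      unfolding f_def using that pos by (subst ln_le_cancel_iff) (auto intro!: \<phi>_comp_mono)
    have hom: "f i (x + t) (y + t) = f i x y + t / 4" if "i \<in> {1, 2}" for i x y t
    proof -
      have "exp (t / 4) ^ 4 = exp t" by (simp add: exp_of_nat_mult[symmetric])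
      hence "\<phi>_comp E e i (exp (x + t), exp (y + t)) = exp (t / 4) * \<phi>_comp E e i (exp x, exp y)"
        using \<phi>_comp_scale[of "exp (t / 4)" i "exp x" "exp y"] by (simp add: exp_add mult.commute)
      thus ?thesis unfolding f_def using pos[OF that, of x y] by (simp add: ln_mult)
    qed
    have dep: "(f 2 x y - f 2 x' y) / 4 \<le> f 1 x y - f 1 x' y" if "x' \<le> x" for x x' y
      using \<phi>_comp_dependence(1)[of "exp x'" "exp y" "exp x"] that by (simp add: f_def)
    have dep': "(f 1 x y - f 1 x y') / 4 \<le> f 2 x y - f 2 x y'" if "y' \<le> y" for x y y'
      using \<phi>_comp_dependence(2)[of "exp x" "exp y'" "exp y"] that by (simp add: f_def)
    define X where "X n = ln (fst ((\<phi> E e ^^ n) (1, 1)))" for n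
    define Y where "Y n = ln (snd ((\<phi> E e ^^ n) (1, 1)))" for n
    have "X (Suc n) = f 1 (X n) (Y n)" "Y (Suc n) = f 2 (X n) (Y n)" for n
      using \<phi>_iterate_pos[of n] by (simp_all add: X_def Y_def f_def \<phi>_def)
    thus ?thesis unfolding c_seq_eq X_def[symmetric] Y_def[symmetric]
      using mono hom dep dep' that
      by (intro iterate_average_antimono[of "f 1" "f 2" X Y]) (auto simp: X_def Y_def)
  qed
  show ?thesis
  proof (rule monotone_onI)
    fix m n :: nat assume m: "m \<in> {1..}" and "m \<le> n"
    from \<open>m \<le> n\<close> show "c_seq E e n \<le> c_seq E e m"
    proof (induction rule: dec_induct)
      case (step k)
      with m have "c_seq E e (Suc k) \<le> c_seq E e k" by (intro c_step) auto
      with step.IH show ?case by simp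
    qed simp
  qed
qed

end

section \<open>The maximum of the local height difference\<close>

lemma double_in_points:
  assumes "P \<in> points E"
  shows "double E P \<in> points E"
proof (cases P)
  case Infinity
  thus ?thesis by (simp add: double_def points_def)
next
  case (Affine x y)
  define w where "w = 2 * y + a1 E * x + a3 E"
  have curve: "y\<^sup>2 + a1 E * x * y + a3 E * y = x ^ 3 + a2 E * x\<^sup>2 + a4 E * x + a6 E"
    using assms Affine by (simp add: points_def)
  show ?thesis
  proof (cases "w = 0")
    case True
    thus ?thesis using Affine by (simp add: double_def points_def w_def)
  next
    case False
    define l where "l = (3 * x\<^sup>2 + 2 * a2 E * x + a4 E - a1 E * y) / w"
    have lw: "l * (2 * y + a1 E * x + a3 E) = 3 * x\<^sup>2 + 2 * a2 E * x + a4 E - a1 E * y"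
      using False by (simp add: l_def w_def)
    define x' where "x' = l\<^sup>2 + a1 E * l - a2 E - x - x"
    define y' where "y' = - (y + l * (x' - x)) - a1 E * x' - a3 E"
    have d: "double E P = Affine x' y'"
      using False Affine by (auto simp: double_def w_def l_def Let_def x'_def y'_def)
    have "y'\<^sup>2 + a1 E * x' * y' + a3 E * y' = x' ^ 3 + a2 E * x'\<^sup>2 + a4 E * x' + a6 E"
      unfolding y'_def using curve lw x'_def by algebra
    thus ?thesis by (simp add: d points_def)
  qed
qed

section \<open>Duplication on homogeneous coordinates\<close>

definition \<delta> :: "weierstrass \<Rightarrow> complex \<times> complex \<Rightarrow> complex \<times> complex" where
  "\<delta> E v = (\<delta>1 E v, \<delta>2 E v)"

lemma \<delta>_sel [simp]: "fst (\<delta> E v) = \<delta>1 E v" "snd (\<delta> E v) = \<delta>2 E v"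
  by (simp_all add: \<delta>_def)

definition height :: "complex \<times> complex \<Rightarrow> real" where
  "height v = max (cmod (fst v)) (cmod (snd v))"

text \<open>Lifting \<Psi> to nonzero vectors makes continuity and compactness available, as
  \<open>point\<close> carries no topology here.\<close>

definition \<Psi>_rep :: "weierstrass \<Rightarrow> complex \<times> complex \<Rightarrow> real" where
  "\<Psi>_rep E v = - (\<Sum>n. ln (\<Phi>_rep E ((\<delta> E ^^ n) v)) / 4 ^ (n + 1))"

lemma height_pos_iff: "height v > 0 \<longleftrightarrow> v \<noteq> 0"
  by (cases v) (auto simp: height_def less_max_iff_disj zero_prod_def)

lemma \<Phi>_rep_height: "\<Phi>_rep E v = height (\<delta> E v) / height v ^ 4"
  by (simp add: \<Phi>_rep_def height_def \<delta>_def)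

lemma represents_nonzero: "represents v P \<Longrightarrow> v \<noteq> 0"
  by (cases v; cases P) (auto simp: zero_prod_def)

lemma represents_double_iterate:
  assumes "elliptic_curve E" "P \<in> points E" "represents v P"
  shows "(double E ^^ n) P \<in> points E \<and> represents ((\<delta> E ^^ n) v) ((double E ^^ n) P)"
  by (induction n) (auto simp: assms double_in_points \<delta>_def represents_double)

lemma \<Psi>_eq_\<Psi>_rep:
  assumes "elliptic_curve E" "P \<in> points E" "represents v P"
  shows "\<Psi> E P = \<Psi>_rep E v"
proof -
  have "\<Phi> E ((double E ^^ n) P) = \<Phi>_rep E ((\<delta> E ^^ n) v)" for n
    using represents_double_iterate[OF assms] by (intro \<Phi>_eq) auto
  thus ?thesis by (simp add: \<Psi>_def \<Psi>_rep_def)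
qed

text \<open>Completing the square in \<open>y\<close> and taking a complex square root solves the
  curve equation over every \<open>x\<close>. This turns a maximising vector into a point.\<close>

lemma points_represent_all:
  assumes "v \<noteq> 0"
  obtains P where "P \<in> points E" "represents v P"
proof (cases "snd v = 0")
  case True
  with assms have "represents v Infinity" by (cases v) (auto simp: zero_prod_def)
  thus ?thesis by (intro that[of Infinity]) (auto simp: points_def)
next
  case False
  define x where "x = fst v / snd v"
  define c where "c = x ^ 3 + a2 E * x\<^sup>2 + a4 E * x + a6 E"
  define h where "h = (a1 E * x + a3 E) / 2"
  define y where "y = csqrt (c + h\<^sup>2) - h"
  have "y\<^sup>2 + a1 E * x * y + a3 E * y = (y + h)\<^sup>2 - h\<^sup>2"
    by (simp add: h_def power2_eq_square field_simps)
  also have "\<dots> = c" by (simp add: y_def)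
  finally have "Affine x y \<in> points E" by (simp add: points_def c_def)
  moreover have "represents v (Affine x y)" using False by (cases v) (auto simp: x_def)
  ultimately show ?thesis by (rule that)
qed

lemma continuous_on_\<delta>: "continuous_on S (\<delta> E)"
  unfolding \<delta>_def \<delta>1_def \<delta>2_def case_prod_beta by (intro continuous_intros)

lemma continuous_on_height: "continuous_on S height"
  unfolding height_def by (intro continuous_intros)

lemma compact_height_sphere: "compact {v. height v = 1}"
proof -
  have "closed {v. height v = 1}"
    by (intro closed_Collect_eq continuous_on_height continuous_on_const)
  moreover have "norm v \<le> 2" if "height v = 1" for v
  proof -
    have "cmod (fst v) \<le> 1" "cmod (snd v) \<le> 1"
      using that max.cobounded1[of "cmod (fst v)" "cmod (snd v)"]
        max.cobounded2[of "cmod (snd v)" "cmod (fst v)"] by (auto simp: height_def)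
    thus ?thesis using norm_Pair_le[of "fst v" "snd v"] by simp
  qed
  ultimately show ?thesis by (auto simp: compact_eq_bounded_closed bounded_iff)
qed

section \<open>Convergence, continuity and iteration of the lifted function\<close>

context two_torsion_numbering
begin

text \<open>As \<phi> vanishes at \<open>(0, 0)\<close>, the coordinate bound forces
  \<open>v = 0\<close> once both forms vanish; this takes the place of a resultant.\<close>

lemma \<delta>_nonzero:
  assumes "v \<noteq> 0"
  shows "\<delta> E v \<noteq> 0"
proof
  assume "\<delta> E v = 0"
  hence "\<delta>1 E v = 0" "\<delta>2 E v = 0" by (auto simp: \<delta>_def zero_prod_def)
  with norm_le_\<phi>_comp[of v] have "cmod (fst v) \<le> 0" "cmod (snd v) \<le> 0"
    by (simp_all add: \<phi>_comp_eq)
  with assms show False by (cases v) (auto simp: zero_prod_def)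
qed

lemma \<delta>_iterate_nonzero: "v \<noteq> 0 \<Longrightarrow> (\<delta> E ^^ n) v \<noteq> 0"
  by (induction n) (auto simp: \<delta>_nonzero)

lemma \<Phi>_rep_pos: "v \<noteq> 0 \<Longrightarrow> \<Phi>_rep E v > 0"
  unfolding \<Phi>_rep_height
  by (intro divide_pos_pos zero_less_power) (simp_all add: height_pos_iff \<delta>_nonzero)

lemma continuous_on_ln_\<Phi>_rep:
  assumes "0 \<notin> S"
  shows "continuous_on S (\<lambda>v. ln (\<Phi>_rep E v))"
proof -
  have "height v \<noteq> 0" "height (\<delta> E v) \<noteq> 0" if "v \<in> S" for v
    using that assms height_pos_iff[of v] height_pos_iff[of "\<delta> E v"] \<delta>_nonzero[of v] by auto
  thus ?thesis unfolding \<Phi>_rep_height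
    by (intro continuous_intros continuous_on_compose2[OF continuous_on_height[of UNIV]]
        continuous_on_\<delta> continuous_on_height) auto
qed

lemma normalise_height:
  assumes "v \<noteq> 0"
  obtains c u where "c \<noteq> 0" "height u = 1" "v = (c * fst u, c * snd u)"
proof (rule that)
  define c where "c = complex_of_real (height v)"
  have h: "height v > 0" using assms by (simp add: height_pos_iff)
  show "c \<noteq> 0" using h by (simp add: c_def)
  show "v = (c * fst (fst v / c, snd v / c), c * snd (fst v / c, snd v / c))"
    using h by (simp add: c_def)
  have "height (fst v / c, snd v / c) = max (cmod (fst v) / height v) (cmod (snd v) / height v)"
    using h by (simp add: height_def[of "(_, _)"] c_def norm_divide)
  also have "\<dots> = max (cmod (fst v)) (cmod (snd v)) / height v"
    using h by (subst max_divide_distrib_right) simp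
  also have "\<dots> = height v / height v" by (simp only: height_def)
  finally have "height (fst v / c, snd v / c) = height v / height v" .
  thus "height (fst v / c, snd v / c) = 1" using h by simp
qed

text \<open>The quotient is homogeneous of degree 0, so a bound on the compact set
  \<open>height v = 1\<close> is global. It therefore also covers iterates that leave this
  set.\<close>

lemma ln_\<Phi>_rep_bounded:
  "\<exists>C. \<forall>v. v \<noteq> 0 \<longrightarrow> \<bar>ln (\<Phi>_rep E v)\<bar> \<le> C"
proof -
  have "0 \<notin> {v. height v = 1}" using height_pos_iff[of 0] by auto
  hence "bounded ((\<lambda>v. ln (\<Phi>_rep E v)) ` {v. height v = 1})"
    by (intro compact_imp_bounded compact_continuous_image continuous_on_ln_\<Phi>_rep
        compact_height_sphere)
  then obtain C where C: "\<forall>x\<in>(\<lambda>v. ln (\<Phi>_rep E v)) ` {v. height v = 1}. norm x \<le> C"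
    unfolding bounded_iff by blast
  have "\<bar>ln (\<Phi>_rep E v)\<bar> \<le> C" if nz: "v \<noteq> 0" for v
  proof -
    obtain c u where "c \<noteq> 0" "height u = 1" "v = (c * fst u, c * snd u)"
      using normalise_height[OF nz] by blast
    thus ?thesis using bspec[OF C, of "ln (\<Phi>_rep E u)"] \<Phi>_rep_scale[of c E "fst u" "snd u"] by simp
  qed
  thus ?thesis by blast
qed

lemma summable_quarter: "summable (\<lambda>n. C / 4 ^ (n + 1) :: real)"
  using summable_mult[OF summable_geometric[of "1 / 4 :: real"], of "C / 4"]
  by (simp add: power_divide)

lemma summable_\<Psi>_rep:
  assumes "v \<noteq> 0"
  shows "summable (\<lambda>n. ln (\<Phi>_rep E ((\<delta> E ^^ n) v)) / 4 ^ (n + 1))"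
proof -
  obtain C where C: "\<And>v. v \<noteq> 0 \<Longrightarrow> \<bar>ln (\<Phi>_rep E v)\<bar> \<le> C"
    using ln_\<Phi>_rep_bounded by blast
  show ?thesis
    by (rule summable_comparison_test'[OF summable_quarter[of C], of 0])
      (simp add: C \<delta>_iterate_nonzero assms divide_right_mono)
qed

text \<open>Weierstrass M-test with majorant \<open>C / 4 ^ (n + 1)\<close>.\<close>

lemma continuous_on_\<Psi>_rep: "continuous_on {v. height v = 1} (\<Psi>_rep E)"
proof -
  let ?S = "{v. height v = 1}"
  obtain C where C: "\<And>v. v \<noteq> 0 \<Longrightarrow> \<bar>ln (\<Phi>_rep E v)\<bar> \<le> C"
    using ln_\<Phi>_rep_bounded by blast
  have nz: "v \<noteq> 0" if "v \<in> ?S" for v using that height_pos_iff[of v] by auto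
  have iter: "continuous_on ?S (\<delta> E ^^ n)" for n
  proof (induction n)
    case (Suc n)
    show ?case unfolding funpow.simps
      by (rule continuous_on_compose[OF Suc.IH continuous_on_\<delta>])
  qed (simp add: id_def)
  have summand: "continuous_on ?S (\<lambda>v. ln (\<Phi>_rep E ((\<delta> E ^^ n) v)) / 4 ^ (n + 1))" for n
    by (intro continuous_intros
        continuous_on_compose2[OF continuous_on_ln_\<Phi>_rep[of "- {0}"] iter])
      (auto simp: \<delta>_iterate_nonzero nz)
  have "uniform_limit ?S (\<lambda>m v. \<Sum>n<m. ln (\<Phi>_rep E ((\<delta> E ^^ n) v)) / 4 ^ (n + 1))
      (\<lambda>v. \<Sum>n. ln (\<Phi>_rep E ((\<delta> E ^^ n) v)) / 4 ^ (n + 1)) sequentially"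
    by (rule Weierstrass_m_test[OF _ summable_quarter[of C]])
      (simp add: C \<delta>_iterate_nonzero nz divide_right_mono)
  hence "continuous_on ?S (\<lambda>v. \<Sum>n. ln (\<Phi>_rep E ((\<delta> E ^^ n) v)) / 4 ^ (n + 1))"
    by (rule uniform_limit_theorem[OF _ _ trivial_limit_sequentially, rotated])
      (intro always_eventually allI continuous_on_sum summand)
  thus ?thesis unfolding \<Psi>_rep_def by (intro continuous_intros)
qed

text \<open>Each summand is a difference of consecutive \<open>ln (height _) / 4 ^ n\<close>, so the
  first \<open>N\<close> telescope; the tail is the same series started at the \<open>N\<close>-th
  iterate.\<close>

lemma \<Psi>_rep_iterate:
  assumes "v \<noteq> 0"
  shows "\<Psi>_rep E v =
    ln (height v) - ln (height ((\<delta> E ^^ N) v)) / 4 ^ N + \<Psi>_rep E ((\<delta> E ^^ N) v) / 4 ^ N"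
proof -
  let ?t = "\<lambda>v n. ln (\<Phi>_rep E ((\<delta> E ^^ n) v)) / 4 ^ (n + 1)"
  have telescope: "(\<Sum>n<N. ?t v n) = ln (height ((\<delta> E ^^ N) v)) / 4 ^ N - ln (height v)"
  proof (induction N)
    case (Suc N)
    have "height ((\<delta> E ^^ N) v) > 0" "height (\<delta> E ((\<delta> E ^^ N) v)) > 0"
      using assms by (auto simp: height_pos_iff \<delta>_iterate_nonzero \<delta>_nonzero)
    hence "ln (\<Phi>_rep E ((\<delta> E ^^ N) v)) =
        ln (height ((\<delta> E ^^ Suc N) v)) - 4 * ln (height ((\<delta> E ^^ N) v))"
      unfolding \<Phi>_rep_height by (simp add: ln_div ln_realpow)
    thus ?case unfolding sum.lessThan_Suc Suc.IH by (simp add: diff_divide_distrib)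
  qed simp
  have "?t v (n + N) = ?t ((\<delta> E ^^ N) v) n / 4 ^ N" for n
    by (simp add: funpow_add power_add)
  hence "(\<Sum>n. ?t v (n + N)) = (\<Sum>n. ?t ((\<delta> E ^^ N) v) n) / 4 ^ N"
    using suminf_divide[OF summable_\<Psi>_rep[OF \<delta>_iterate_nonzero[OF assms, of N]], of "4 ^ N"] by simp
  with suminf_split_initial_segment[OF summable_\<Psi>_rep[OF assms], of N] telescope
  show ?thesis by (simp add: \<Psi>_rep_def)
qed

lemma \<phi>_iterate_mono:
  assumes "fst d \<le> fst d'" "snd d \<le> snd d'"
  shows "fst ((\<phi> E e ^^ n) d) \<le> fst ((\<phi> E e ^^ n) d') \<and> snd ((\<phi> E e ^^ n) d) \<le> snd ((\<phi> E e ^^ n) d')"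
proof (induction n)
  case (Suc n)
  hence "\<phi>_comp E e i ((\<phi> E e ^^ n) d) \<le> \<phi>_comp E e i ((\<phi> E e ^^ n) d')" for i
    using \<phi>_comp_mono[of "fst ((\<phi> E e ^^ n) d)" "fst ((\<phi> E e ^^ n) d')"
        "snd ((\<phi> E e ^^ n) d)" "snd ((\<phi> E e ^^ n) d')"] by simp
  thus ?case by (simp add: \<phi>_def[where d = "(\<phi> E e ^^ n) _"])
qed (use assms in auto)

lemma \<phi>_iterate_scale:
  assumes "t \<ge> 0"
  shows "(\<phi> E e ^^ n) (t ^ 4 ^ n * d1, t ^ 4 ^ n * d2) =
    (t * fst ((\<phi> E e ^^ n) (d1, d2)), t * snd ((\<phi> E e ^^ n) (d1, d2)))"
  using assms
proof (induction n arbitrary: t)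
  case (Suc n)
  have "t ^ 4 ^ Suc n = (t ^ 4) ^ 4 ^ n" by (simp add: power_mult)
  thus ?case using Suc.IH[of "t ^ 4"] Suc.prems by (simp add: \<phi>_def \<phi>_comp_scale)
qed simp

lemma norm_le_\<phi>_iterate:
  "cmod (fst v) \<le> fst ((\<phi> E e ^^ n) (cmod (fst ((\<delta> E ^^ n) v)), cmod (snd ((\<delta> E ^^ n) v)))) \<and>
   cmod (snd v) \<le> snd ((\<phi> E e ^^ n) (cmod (fst ((\<delta> E ^^ n) v)), cmod (snd ((\<delta> E ^^ n) v))))"
proof (induction n arbitrary: v)
  case (Suc n)
  \<comment> \<open>The induction hypothesis is used at \<open>\<delta> E v\<close>, and the
    outermost \<phi> then accounts for the first duplication.\<close>
  define d where "d = (\<phi> E e ^^ n) (cmod (fst ((\<delta> E ^^ Suc n) v)), cmod (snd ((\<delta> E ^^ Suc n) v)))"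
  have "cmod (\<delta>1 E v) \<le> fst d" "cmod (\<delta>2 E v) \<le> snd d"
    using Suc.IH[of "\<delta> E v"] by (simp_all add: d_def funpow_swap1)
  hence "\<phi>_comp E e i (cmod (\<delta>1 E v), cmod (\<delta>2 E v)) \<le> \<phi>_comp E e i d" for i
    using \<phi>_comp_mono[of _ "fst d" _ "snd d"] by simp
  with norm_le_\<phi>_comp[of v] have "cmod (fst v) \<le> fst (\<phi> E e d)" "cmod (snd v) \<le> snd (\<phi> E e d)"
    unfolding \<phi>_def fst_conv snd_conv by (meson order_trans)+
  thus ?case by (simp add: d_def)
qed simp

lemma ln_height_le:
  assumes "v \<noteq> 0"
  shows "ln (height v) - ln (height ((\<delta> E ^^ N) v)) / 4 ^ N \<le> ln (sup_norm ((\<phi> E e ^^ N) (1, 1)))"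
proof -
  define w where "w = (\<delta> E ^^ N) v"
  have w: "height w > 0" using assms by (simp add: w_def height_pos_iff \<delta>_iterate_nonzero)
  \<comment> \<open>This is the \<open>4 ^ N\<close>-th root of \<open>height w\<close>, chosen so
    that homogeneity moves the argument to \<open>(1, 1)\<close>.\<close>
  define t where "t = exp (ln (height w) / 4 ^ N)"
  have "t ^ 4 ^ N = height w" using w by (simp add: t_def exp_of_nat_mult[symmetric])
  hence scale: "(\<phi> E e ^^ N) (height w, height w) =
      (t * fst ((\<phi> E e ^^ N) (1, 1)), t * snd ((\<phi> E e ^^ N) (1, 1)))"
    using \<phi>_iterate_scale[of t N 1 1] by (simp add: t_def)
  have "cmod (fst v) \<le> fst ((\<phi> E e ^^ N) (height w, height w))"
    "cmod (snd v) \<le> snd ((\<phi> E e ^^ N) (height w, height w))"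
    using norm_le_\<phi>_iterate[of v N]
      \<phi>_iterate_mono[of "(cmod (fst w), cmod (snd w))" "(height w, height w)" N]
    by (auto simp: w_def height_def)
  moreover have "t * fst ((\<phi> E e ^^ N) (1, 1)) \<le> t * sup_norm ((\<phi> E e ^^ N) (1, 1))"
    "t * snd ((\<phi> E e ^^ N) (1, 1)) \<le> t * sup_norm ((\<phi> E e ^^ N) (1, 1))"
    unfolding sup_norm_def by (intro mult_left_mono; simp add: t_def)+
  ultimately have "height v \<le> t * sup_norm ((\<phi> E e ^^ N) (1, 1))"
    unfolding scale by (auto simp: height_def)
  moreover have "height v > 0" using assms by (simp add: height_pos_iff)
  moreover have "sup_norm ((\<phi> E e ^^ N) (1, 1)) > 0"
    using \<phi>_iterate_pos[of N] by (auto simp: sup_norm_def less_max_iff_disj)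
  ultimately have "ln (height v) \<le> ln (t * sup_norm ((\<phi> E e ^^ N) (1, 1)))" by simp
  also have "\<dots> = ln t + ln (sup_norm ((\<phi> E e ^^ N) (1, 1)))"
    using \<open>sup_norm _ > 0\<close> by (simp add: ln_mult t_def)
  finally have "ln (height v) \<le> ln t + ln (sup_norm ((\<phi> E e ^^ N) (1, 1)))" .
  thus ?thesis by (simp add: t_def w_def)
qed

text \<open>The vector maximises over \<open>height v = 1\<close>; every point has a representative
  there, and the value does not depend on the representative.\<close>

lemma \<Psi>_rep_max:
  assumes "elliptic_curve E"
  obtains v where "v \<noteq> 0" "\<And>Q. Q \<in> points E \<Longrightarrow> \<Psi> E Q \<le> \<Psi>_rep E v"
proof -
  have "(1, 0) \<in> {v. height v = 1}" by (simp add: height_def)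
  hence "{v. height v = 1} \<noteq> {}" by blast
  then obtain v where v: "height v = 1" "\<forall>u\<in>{v. height v = 1}. \<Psi>_rep E u \<le> \<Psi>_rep E v"
    using continuous_attains_sup[OF compact_height_sphere _ continuous_on_\<Psi>_rep] by blast
  show ?thesis
  proof (rule that)
    show "v \<noteq> 0" using v(1) height_pos_iff[of v] by simp
    fix Q assume Q: "Q \<in> points E"
    have "represents (x_rep Q) Q" by (cases Q) auto
    then obtain c u where u: "c \<noteq> 0" "height u = 1" "x_rep Q = (c * fst u, c * snd u)"
      using normalise_height[OF represents_nonzero] by blast
    have "represents u Q"
      unfolding represents_iff_scaled_x_rep using u by (intro exI[of _ "1 / c"]) simp
    moreover have "\<Psi>_rep E u \<le> \<Psi>_rep E v" using v(2) u(2) by blast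
    ultimately show "\<Psi> E Q \<le> \<Psi>_rep E v" using assms Q by (simp add: \<Psi>_eq_\<Psi>_rep)
  qed
qed

end

theorem theorem4p2:
  fixes E :: weierstrass and e :: "nat \<Rightarrow> complex"
  assumes "elliptic_curve E"
    and "bij_betw e {1, 2, 3} (two_torsion_xs E)"
  shows "antimono_on {1..} (c_seq E e) \<and>
    (\<exists>P\<in>points E. (\<forall>Q\<in>points E. \<Psi> E Q \<le> \<Psi> E P) \<and> (\<forall>N\<ge>1. \<Psi> E P \<le> c_seq E e N))"
proof -
  interpret two_torsion_numbering E e by unfold_locales (rule assms(2))
  obtain v where v: "v \<noteq> 0" "\<And>Q. Q \<in> points E \<Longrightarrow> \<Psi> E Q \<le> \<Psi>_rep E v"
    using \<Psi>_rep_max[OF assms(1)] by blast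
  obtain P where P: "P \<in> points E" "represents v P" using points_represent_all[OF v(1)] .
  have \<Psi>P: "\<Psi> E P = \<Psi>_rep E v" by (rule \<Psi>_eq_\<Psi>_rep[OF assms(1) P])
  have "\<Psi> E P \<le> c_seq E e N" if "N \<ge> 1" for N
  proof -
    define L where "L = ln (sup_norm ((\<phi> E e ^^ N) (1, 1)))"
    \<comment> \<open>\<open>Q\<close> has the x-coordinate of the \<open>N\<close>-fold double of
      \<open>P\<close>, which is all that \<Psi> sees, so maximality bounds the remainder
      term.\<close>
    obtain Q where Q: "Q \<in> points E" "represents ((\<delta> E ^^ N) v) Q"
      using points_represent_all[OF \<delta>_iterate_nonzero[OF v(1)]] .
    have "\<Psi>_rep E ((\<delta> E ^^ N) v) \<le> \<Psi> E P"
      using v(2)[OF Q(1)] \<Psi>_eq_\<Psi>_rep[OF assms(1) Q] by (simp add: \<Psi>P)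
    hence "\<Psi>_rep E ((\<delta> E ^^ N) v) / 4 ^ N \<le> \<Psi> E P / 4 ^ N" by (simp add: divide_right_mono)
    with ln_height_le[OF v(1), of N] \<Psi>_rep_iterate[OF v(1), of N]
    have "\<Psi> E P \<le> L + \<Psi> E P / 4 ^ N" by (simp add: \<Psi>P L_def)
    \<comment> \<open>This is where \<open>N \<ge> 1\<close> enters: it makes
      \<open>1 - 1 / 4 ^ N\<close> positive, so the inequality can be solved for
      \<open>\<Psi> E P\<close>.\<close>
    moreover have "(4 :: real) ^ N > 1" using that by simp
    ultimately have "\<Psi> E P \<le> 4 ^ N / (4 ^ N - 1) * L" by (simp add: field_simps)
    thus ?thesis by (simp add: c_seq_def L_def)
  qed
  with c_seq_antimono P v(2) show ?thesis unfolding \<Psi>P[symmetric] by blast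
qed

end
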